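(* Let $F(n)$ be the free pro-$p$ group with generating system $\{x_1,\ldots,x_n\}$, let $H$ be the free pro-$p$ group with generating system $\{x_1,\ldots,x_{n-1}\}$, let $r$ be an element of the group $F(n)$, and let $R$ be the closed normal subgroup of $F(n)$ generated by the element $r$. Let $\pi:\mathbf{Z}_p[[F(n)]]\to\mathbf{Z}_p[[F(n)/R]]$ be the homomorphism induced by the natural homomorphism $F(n)\to F(n)/R$, and let $\{\partial_1,\ldots,\partial_n\}$ be the Fox derivatives of the algebra $\mathbf{Z}_p[[F(n)]]$. If $H\cap R=1$, then $\pi(\partial_n(r))\neq 0$.
   Context: $p$ is a prime and $\mathbf{Z}_p$ is the ring of $p$-adic integers. $H$ is regarded as the closed subgroup of $F(n)$ generated by $x_1,\ldots,x_{n-1}$. For a pro-$p$ group $G$, $\mathbf{Z}_p[[G]]=\varprojlim \mathbf{Z}_p[G/U]$ ($U$ running over the open normal subgroups of $G$) is the completed group ring. Fox derivatives: let $F_n$ be the discrete free group on $x_1,\ldots,x_n$, with $F(n)$ its pro-$p$ completion, and let $\varepsilon:\mathbf{Z}[F_n]\to\mathbf{Z}$ be the augmentation. The Fox derivative $D_k$ $(k=1,\ldots,n)$ is the unique additive map $D_k:\mathbf{Z}[F_n]\to\mathbf{Z}[F_n]$ with $D_k(uv)=D_k(u)v+\varepsilon(u)D_k(v)$ for all $u,v$, $D_k(x_k)=1$ and $D_k(x_j)=0$ for $j\neq k$. The ring $\mathbf{Z}_p[[F(n)]]$ is the completion of $\mathbf{Z}[F_n]$ in the topology given by the ideals generated by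 $p^m$ and $\{1-h\mid h\in N_j\}$, where $m\in\mathbf{N}$ and $N_j$ runs over the normal subgroups of $F_n$ of $p$-power index. The maps $D_k,\varepsilon$ are continuous for this topology, and $\partial_k,\bar\varepsilon$ denote their continuous extensions to $\mathbf{Z}_p[[F(n)]]$. Thus $\partial_k$ is additive and $\partial_k(vw)=\partial_k(v)w+\bar\varepsilon(v)\partial_k(w)$.
   Formalization: The element r is assumed to be different from 1; for r = 1 one has R = 1 and H∩R = 1, but ∂_n(1) = 0, so the statement fails for that single value. *)

theory Defs
  imports "HOL-Analysis.Analysis" "HOL-Algebra.Algebra"
begin

section \<open>Discrete free groups\<close>

text \<open>A letter \<open>(i, True)\<close> stands for the generator \<open>x\<^sub>i\<close> and \<open>(i, False)\<close> for its inverse;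
  the elements of the free group are the freely reduced words.\<close>

type_synonym word = "(nat \<times> bool) list"

definition inverse_letter :: "nat \<times> bool \<Rightarrow> nat \<times> bool" where
  "inverse_letter l = (fst l, \<not> snd l)"

definition reduced :: "word \<Rightarrow> bool" where
  "reduced w \<longleftrightarrow> successively (\<lambda>l m. m \<noteq> inverse_letter l) w"

fun red_cons :: "nat \<times> bool \<Rightarrow> word \<Rightarrow> word" where
  "red_cons l [] = [l]"
| "red_cons l (m # w) = (if m = inverse_letter l then w else l # m # w)"

definition free_group :: "nat \<Rightarrow> word monoid" where
  "free_group n =
     \<lparr>carrier = {w. set w \<subseteq> {1..n} \<times> UNIV \<and> reduced w},
      monoid.mult = (\<lambda>v w. foldr red_cons v w), monoid.one = []\<rparr>"

definition free_gen :: "nat \<Rightarrow> word" where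
  "free_gen k = [(k, True)]"


section \<open>Pro-$p$ completions\<close>

definition p_power_index_normal :: "nat \<Rightarrow> ('g, 'k) monoid_scheme \<Rightarrow> 'g set set" where
  "p_power_index_normal p G = {N. N \<lhd> G \<and> (\<exists>k. order (G Mod N) = p ^ k)}"

text \<open>The inverse limit of the groups \<open>G/N\<close>; for \<open>M \<subseteq> N\<close> the transition map
  \<open>G/M \<rightarrow> G/N\<close> sends a coset \<open>C\<close> to \<open>N C\<close>.\<close>

definition pro_p_completion :: "nat \<Rightarrow> ('g, 'k) monoid_scheme \<Rightarrow> ('g set \<Rightarrow> 'g set) monoid" where
  "pro_p_completion p G =
     product_group (p_power_index_normal p G) (\<lambda>N. G Mod N)
       \<lparr>carrier :=
          {f \<in> \<Pi>\<^sub>E N \<in> p_power_index_normal p G. carrier (G Mod N).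
             \<forall>M \<in> p_power_index_normal p G. \<forall>N \<in> p_power_index_normal p G.
               M \<subseteq> N \<longrightarrow> f N = N <#>\<^bsub>G\<^esub> f M}\<rparr>"

definition pro_p_topology :: "nat \<Rightarrow> ('g, 'k) monoid_scheme \<Rightarrow> ('g set \<Rightarrow> 'g set) topology" where
  "pro_p_topology p G =
     subtopology
       (product_topology (\<lambda>N. discrete_topology (carrier (G Mod N))) (p_power_index_normal p G))
       (carrier (pro_p_completion p G))"

definition completion_map :: "nat \<Rightarrow> ('g, 'k) monoid_scheme \<Rightarrow> 'g \<Rightarrow> ('g set \<Rightarrow> 'g set)" where
  "completion_map p G g = (\<lambda>N \<in> p_power_index_normal p G. N #>\<^bsub>G\<^esub> g)"

definition free_pro_p :: "nat \<Rightarrow> nat \<Rightarrow> (word set \<Rightarrow> word set) monoid" where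
  "free_pro_p p n = pro_p_completion p (free_group n)"

definition free_pro_p_topology :: "nat \<Rightarrow> nat \<Rightarrow> (word set \<Rightarrow> word set) topology" where
  "free_pro_p_topology p n = pro_p_topology p (free_group n)"

definition free_pro_p_gen :: "nat \<Rightarrow> nat \<Rightarrow> nat \<Rightarrow> (word set \<Rightarrow> word set)" where
  "free_pro_p_gen p n k = completion_map p (free_group n) (free_gen k)"


section \<open>Topological groups: generated closed subgroups, quotients\<close>

definition closed_subgroup_generated ::
    "('g, 'k) monoid_scheme \<Rightarrow> 'g topology \<Rightarrow> 'g set \<Rightarrow> 'g set" where
  "closed_subgroup_generated G T A = (\<lambda>K. subgroup K G \<and> closedin T K) hull A"

definition closed_normal_subgroup_generated ::
    "('g, 'k) monoid_scheme \<Rightarrow> 'g topology \<Rightarrow> 'g set \<Rightarrow> 'g set" where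
  "closed_normal_subgroup_generated G T A = (\<lambda>K. K \<lhd> G \<and> closedin T K) hull A"

definition quotient_group_topology ::
    "('g, 'k) monoid_scheme \<Rightarrow> 'g topology \<Rightarrow> 'g set \<Rightarrow> 'g set topology" where
  "quotient_group_topology G T N =
     topology (\<lambda>S. S \<subseteq> carrier (G Mod N) \<and> openin T {g \<in> carrier G. N #>\<^bsub>G\<^esub> g \<in> S})"

lemma openin_quotient_group_topology:
  assumes "topspace T = carrier G"
  shows "openin (quotient_group_topology G T N) S \<longleftrightarrow>
           S \<subseteq> carrier (G Mod N) \<and> openin T {g \<in> carrier G. N #>\<^bsub>G\<^esub> g \<in> S}"
proof -
  let ?pre = "\<lambda>S. {g \<in> carrier G. N #>\<^bsub>G\<^esub> g \<in> S}"
  have "istopology (\<lambda>S. S \<subseteq> carrier (G Mod N) \<and> openin T (?pre S))"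
    unfolding istopology_def
  proof (intro conjI allI impI)
    fix S S' assume a: "S \<subseteq> carrier (G Mod N) \<and> openin T (?pre S)"
      "S' \<subseteq> carrier (G Mod N) \<and> openin T (?pre S')"
    show "S \<inter> S' \<subseteq> carrier (G Mod N)" using a by blast
    have "?pre (S \<inter> S') = ?pre S \<inter> ?pre S'" by blast
    then show "openin T (?pre (S \<inter> S'))" using a by (simp add: openin_Int)
  next
    fix \<K> assume a: "\<forall>K\<in>\<K>. K \<subseteq> carrier (G Mod N) \<and> openin T (?pre K)"
    show "\<Union>\<K> \<subseteq> carrier (G Mod N)" using a by blast
    have "?pre (\<Union>\<K>) = (\<Union>K\<in>\<K>. ?pre K)" by blast
    moreover have "openin T (\<Union>K\<in>\<K>. ?pre K)"
      using a by (intro openin_Union) blast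
    ultimately show "openin T (?pre (\<Union>\<K>))" by simp
  qed
  then show ?thesis
    by (simp add: quotient_group_topology_def topology_inverse')
qed


section \<open>The ring of $p$-adic integers\<close>

text \<open>An element \<open>a\<close> is a coherent sequence of residues \<open>a m \<in> {0..<p ^ m}\<close>.\<close>

definition padic_int :: "nat \<Rightarrow> (nat \<Rightarrow> int) ring" where
  "padic_int p =
     \<lparr>carrier = {a. \<forall>m. a m \<in> {0..<int p ^ m} \<and> a (Suc m) mod int p ^ m = a m},
      monoid.mult = (\<lambda>a b m. (a m * b m) mod int p ^ m),
      monoid.one = (\<lambda>m. 1 mod int p ^ m),
      ring.zero = (\<lambda>m. 0),
      ring.add = (\<lambda>a b m. (a m + b m) mod int p ^ m)\<rparr>"

definition padic_topology :: "nat \<Rightarrow> (nat \<Rightarrow> int) topology" where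
  "padic_topology p =
     subtopology (product_topology (\<lambda>m. discrete_topology UNIV) UNIV) (carrier (padic_int p))"

definition padic_of_int :: "nat \<Rightarrow> int \<Rightarrow> (nat \<Rightarrow> int)" where
  "padic_of_int p z = (\<lambda>m. z mod int p ^ m)"


section \<open>Group rings\<close>

definition group_ring ::
    "('r, 'm) ring_scheme \<Rightarrow> ('g, 'k) monoid_scheme \<Rightarrow> ('g \<Rightarrow> 'r) ring" where
  "group_ring R G =
     \<lparr>carrier = {a \<in> carrier G \<rightarrow>\<^sub>E carrier R. finite {g \<in> carrier G. a g \<noteq> \<zero>\<^bsub>R\<^esub>}},
      monoid.mult = (\<lambda>a b. \<lambda>g\<in>carrier G.
                \<Oplus>\<^bsub>R\<^esub>h\<in>{h \<in> carrier G. a h \<noteq> \<zero>\<^bsub>R\<^esub>}. a h \<otimes>\<^bsub>R\<^esub> b (inv\<^bsub>G\<^esub> h \<otimes>\<^bsub>G\<^esub> g)),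
      monoid.one = (\<lambda>g\<in>carrier G. if g = \<one>\<^bsub>G\<^esub> then \<one>\<^bsub>R\<^esub> else \<zero>\<^bsub>R\<^esub>),
      ring.zero = (\<lambda>g\<in>carrier G. \<zero>\<^bsub>R\<^esub>),
      ring.add = (\<lambda>a b. \<lambda>g\<in>carrier G. a g \<oplus>\<^bsub>R\<^esub> b g)\<rparr>"

definition group_ring_of ::
    "('r, 'm) ring_scheme \<Rightarrow> ('g, 'k) monoid_scheme \<Rightarrow> 'g \<Rightarrow> ('g \<Rightarrow> 'r)" where
  "group_ring_of R G g = (\<lambda>h\<in>carrier G. if h = g then \<one>\<^bsub>R\<^esub> else \<zero>\<^bsub>R\<^esub>)"

text \<open>The \<open>R\<close>-linear map \<open>R[G] \<rightarrow> R[G']\<close> extending \<open>h : G \<rightarrow> G'\<close>.\<close>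

definition group_ring_map ::
    "('r, 'm) ring_scheme \<Rightarrow> ('g, 'k) monoid_scheme \<Rightarrow> ('h, 'l) monoid_scheme \<Rightarrow> ('g \<Rightarrow> 'h) \<Rightarrow>
     ('g \<Rightarrow> 'r) \<Rightarrow> ('h \<Rightarrow> 'r)" where
  "group_ring_map R G G' h a =
     (\<lambda>y\<in>carrier G'. \<Oplus>\<^bsub>R\<^esub>x\<in>{x \<in> carrier G. a x \<noteq> \<zero>\<^bsub>R\<^esub> \<and> h x = y}. a x)"

definition augmentation ::
    "('r, 'm) ring_scheme \<Rightarrow> ('g, 'k) monoid_scheme \<Rightarrow> ('g \<Rightarrow> 'r) \<Rightarrow> 'r" where
  "augmentation R G a = (\<Oplus>\<^bsub>R\<^esub>x\<in>{x \<in> carrier G. a x \<noteq> \<zero>\<^bsub>R\<^esub>}. a x)"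


section \<open>Completed group rings\<close>

definition open_normal_subgroups :: "('g, 'k) monoid_scheme \<Rightarrow> 'g topology \<Rightarrow> 'g set set" where
  "open_normal_subgroups G T = {U. U \<lhd> G \<and> openin T U}"

text \<open>The inverse limit of the rings \<open>\<int>\<^sub>p[G/U]\<close>, \<open>U\<close> an open normal subgroup of the
  topological group \<open>(G, T)\<close>.\<close>

definition completed_group_ring ::
    "nat \<Rightarrow> ('g, 'k) monoid_scheme \<Rightarrow> 'g topology \<Rightarrow> ('g set \<Rightarrow> 'g set \<Rightarrow> nat \<Rightarrow> int) ring" where
  "completed_group_ring p G T =
     \<lparr>carrier =
        {a \<in> \<Pi>\<^sub>E U \<in> open_normal_subgroups G T. carrier (group_ring (padic_int p) (G Mod U)).
           \<forall>U \<in> open_normal_subgroups G T. \<forall>V \<in> open_normal_subgroups G T. U \<subseteq> V \<longrightarrow>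
             group_ring_map (padic_int p) (G Mod U) (G Mod V) (\<lambda>C. V <#>\<^bsub>G\<^esub> C) (a U) = a V},
      monoid.mult = (\<lambda>a b. \<lambda>U\<in>open_normal_subgroups G T.
                a U \<otimes>\<^bsub>group_ring (padic_int p) (G Mod U)\<^esub> b U),
      monoid.one = (\<lambda>U\<in>open_normal_subgroups G T. \<one>\<^bsub>group_ring (padic_int p) (G Mod U)\<^esub>),
      ring.zero = (\<lambda>U\<in>open_normal_subgroups G T. \<zero>\<^bsub>group_ring (padic_int p) (G Mod U)\<^esub>),
      ring.add = (\<lambda>a b. \<lambda>U\<in>open_normal_subgroups G T.
                a U \<oplus>\<^bsub>group_ring (padic_int p) (G Mod U)\<^esub> b U)\<rparr>"

text \<open>The inverse limit topology, each \<open>\<int>\<^sub>p[G/U]\<close> carrying the coefficientwise \<open>p\<close>-adic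
  topology.\<close>

definition completed_group_ring_topology ::
    "nat \<Rightarrow> ('g, 'k) monoid_scheme \<Rightarrow> 'g topology \<Rightarrow> ('g set \<Rightarrow> 'g set \<Rightarrow> nat \<Rightarrow> int) topology" where
  "completed_group_ring_topology p G T =
     subtopology
       (product_topology
          (\<lambda>U. product_topology (\<lambda>C. padic_topology p) (carrier (G Mod U)))
          (open_normal_subgroups G T))
       (carrier (completed_group_ring p G T))"

definition completed_group_ring_of ::
    "nat \<Rightarrow> ('g, 'k) monoid_scheme \<Rightarrow> 'g topology \<Rightarrow> 'g \<Rightarrow> ('g set \<Rightarrow> 'g set \<Rightarrow> nat \<Rightarrow> int)" where
  "completed_group_ring_of p G T g =
     (\<lambda>U\<in>open_normal_subgroups G T. group_ring_of (padic_int p) (G Mod U) (U #>\<^bsub>G\<^esub> g))"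

text \<open>The homomorphism \<open>\<int>\<^sub>p[[G]] \<rightarrow> \<int>\<^sub>p[[G']]\<close> induced by a continuous homomorphism \<open>q : G \<rightarrow> G'\<close>.
  Its component at \<open>V\<close> comes from the homomorphism \<open>G/q\<^sup>-\<^sup>1(V) \<rightarrow> G'/V\<close>, which sends a coset \<open>C\<close>
  to \<open>V q(C)\<close>.\<close>

definition completed_group_ring_map ::
    "nat \<Rightarrow> ('g, 'k) monoid_scheme \<Rightarrow> ('h, 'l) monoid_scheme \<Rightarrow> 'h topology \<Rightarrow> ('g \<Rightarrow> 'h) \<Rightarrow>
     ('g set \<Rightarrow> 'g set \<Rightarrow> nat \<Rightarrow> int) \<Rightarrow> ('h set \<Rightarrow> 'h set \<Rightarrow> nat \<Rightarrow> int)" where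
  "completed_group_ring_map p G G' T' q a =
     (\<lambda>V\<in>open_normal_subgroups G' T'.
        group_ring_map (padic_int p) (G Mod {g \<in> carrier G. q g \<in> V}) (G' Mod V)
          (\<lambda>C. V <#>\<^bsub>G'\<^esub> (q ` C)) (a {g \<in> carrier G. q g \<in> V}))"


section \<open>Fox derivatives\<close>

abbreviation int_free_group_ring :: "nat \<Rightarrow> (word \<Rightarrow> int) ring" where
  "int_free_group_ring n \<equiv> group_ring \<Z> (free_group n)"

definition is_discrete_fox_derivative ::
    "nat \<Rightarrow> nat \<Rightarrow> ((word \<Rightarrow> int) \<Rightarrow> (word \<Rightarrow> int)) \<Rightarrow> bool" where
  "is_discrete_fox_derivative n k D \<longleftrightarrow>
     D \<in> carrier (int_free_group_ring n) \<rightarrow> carrier (int_free_group_ring n) \<and>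
     (\<forall>u \<in> carrier (int_free_group_ring n). \<forall>v \<in> carrier (int_free_group_ring n).
        D (u \<oplus>\<^bsub>int_free_group_ring n\<^esub> v) = D u \<oplus>\<^bsub>int_free_group_ring n\<^esub> D v \<and>
        D (u \<otimes>\<^bsub>int_free_group_ring n\<^esub> v) =
          D u \<otimes>\<^bsub>int_free_group_ring n\<^esub> v \<oplus>\<^bsub>int_free_group_ring n\<^esub>
          [augmentation \<Z> (free_group n) u] \<cdot>\<^bsub>int_free_group_ring n\<^esub> D v) \<and>
     (\<forall>j \<in> {1..n}. D (group_ring_of \<Z> (free_group n) (free_gen j)) =
        (if j = k then \<one>\<^bsub>int_free_group_ring n\<^esub> else \<zero>\<^bsub>int_free_group_ring n\<^esub>))"

abbreviation free_completed_ring ::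
    "nat \<Rightarrow> nat \<Rightarrow> ((word set \<Rightarrow> word set) set \<Rightarrow> (word set \<Rightarrow> word set) set \<Rightarrow> nat \<Rightarrow> int) ring" where
  "free_completed_ring p n \<equiv> completed_group_ring p (free_pro_p p n) (free_pro_p_topology p n)"

abbreviation free_completed_ring_topology ::
    "nat \<Rightarrow> nat \<Rightarrow> ((word set \<Rightarrow> word set) set \<Rightarrow> (word set \<Rightarrow> word set) set \<Rightarrow> nat \<Rightarrow> int) topology" where
  "free_completed_ring_topology p n \<equiv>
     completed_group_ring_topology p (free_pro_p p n) (free_pro_p_topology p n)"

text \<open>The canonical map from \<open>\<int>[F\<^sub>n]\<close> to \<open>\<int>\<^sub>p[[F(n)]]\<close> exhibiting the latter as the completion
  of the former: the topology it induces on \<open>\<int>[F\<^sub>n]\<close> is the one given by the ideals generated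
  by \<open>p ^ m\<close> and the \<open>1 - h\<close>, \<open>h\<close> in a normal subgroup of \<open>p\<close>-power index.\<close>

definition int_free_group_ring_embedding ::
    "nat \<Rightarrow> nat \<Rightarrow> (word \<Rightarrow> int) \<Rightarrow>
     ((word set \<Rightarrow> word set) set \<Rightarrow> (word set \<Rightarrow> word set) set \<Rightarrow> nat \<Rightarrow> int)" where
  "int_free_group_ring_embedding p n a =
     (\<lambda>U\<in>open_normal_subgroups (free_pro_p p n) (free_pro_p_topology p n).
        group_ring_map (padic_int p) (free_group n) (free_pro_p p n Mod U)
          (\<lambda>w. U #>\<^bsub>free_pro_p p n\<^esub> completion_map p (free_group n) w)
          (\<lambda>w\<in>carrier (free_group n). padic_of_int p (a w)))"

definition is_fox_derivative ::
    "nat \<Rightarrow> nat \<Rightarrow> nat \<Rightarrow>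
     (((word set \<Rightarrow> word set) set \<Rightarrow> (word set \<Rightarrow> word set) set \<Rightarrow> nat \<Rightarrow> int) \<Rightarrow>
      ((word set \<Rightarrow> word set) set \<Rightarrow> (word set \<Rightarrow> word set) set \<Rightarrow> nat \<Rightarrow> int)) \<Rightarrow> bool" where
  "is_fox_derivative p n k d \<longleftrightarrow>
     continuous_map (free_completed_ring_topology p n) (free_completed_ring_topology p n) d \<and>
     (\<exists>D. is_discrete_fox_derivative n k D \<and>
        (\<forall>a \<in> carrier (int_free_group_ring n).
           d (int_free_group_ring_embedding p n a) = int_free_group_ring_embedding p n (D a)))"

end

theory Submission
  imports Defs "HOL-Number_Theory.Cong"
begin

text \<open>Read a word \<open>w\<close> from right to left as a path in the Cayley graph of \<open>F(n)/V\<close>, for an open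
  normal subgroup \<open>V \<supseteq> R\<close>. The coefficients of \<open>\<partial>\<^sub>k(w)\<close> modulo \<open>V\<close> count, with signs, how often the
  path runs through each edge with label \<open>x\<^sub>k\<close>. If \<open>\<pi>(\<partial>\<^sub>n(r))\<close> were zero, then \<open>r\<close> would give, for
  every such \<open>V\<close>, a cycle that modulo \<open>p\<close> uses only the labels \<open>x\<^sub>1, \<dots>, x\<^sub>n\<^sub>-\<^sub>1\<close>. The components of
  that part of the graph are translates of the Cayley graph of \<open>H/(H \<inter> V)\<close>, and \<open>H \<inter> R = 1\<close> forces
  \<open>H \<inter> V\<close> to shrink to \<open>1\<close> as \<open>V\<close> shrinks to \<open>R\<close>. So a homomorphism \<open>V \<rightarrow> \<int>/p\<close> that is trivial near
  \<open>1\<close> cannot detect the cycle once \<open>V\<close> is small. But \<open>r \<noteq> 1\<close> generates \<open>R\<close> as a closed normal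
  subgroup, and this yields a homomorphism that does detect it.

  Everything takes place in finite quotients of the discrete free group \<open>F\<close>. The detecting
  homomorphism \<open>\<phi>\<close> comes from a finite \<open>p\<close>-quotient in which \<open>r\<close> is central of order \<open>p\<close>
  (\<open>exists_central_component\<close>); there \<open>R\<close> has the image \<open>{r\<^sup>i}\<close> and \<open>\<phi>\<close> is the exponent
  \<open>i\<close>. Compactness (\<open>separate_closed_sets\<close>) gives a \<open>V\<close> for which \<open>\<phi>\<close> vanishes on the conjugates of
  \<open>H \<inter> V\<close>; this is \<open>exists_character\<close>. Instead of working with the homology of graphs, the proof
  extends \<open>\<phi>\<close> to a potential \<open>\<tau>\<close> on \<open>F\<close> that is invariant under left multiplication by \<open>x\<^sub>1, \<dots>, x\<^sub>n\<^sub>-\<^sub>1\<close>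
  (\<open>double_coset_extension\<close>). Along the path of \<open>w\<close>, only the edges with label \<open>x\<^sub>n\<close> change \<open>\<tau>\<close>, by an
  amount that depends on the edge modulo \<open>V\<close> alone. Hence \<open>\<phi>(w)\<close> is a linear combination of the coefficients
  of \<open>\<partial>\<^sub>n(w)\<close> modulo \<open>V\<close> (\<open>fox_fundamental_formula\<close>), and \<open>\<phi>(w) \<noteq> 0\<close> makes one of them nonzero
  modulo \<open>p\<close> (\<open>fox_derivative_mod_nonzero\<close>).

  The passage from words to \<open>r\<close> uses the continuity of \<open>\<partial>\<^sub>n\<close>: at the level of \<open>V\<close> and modulo \<open>p\<close>, the
  value \<open>\<partial>\<^sub>n(r)\<close> agrees with \<open>\<partial>\<^sub>n(w)\<close> for every word \<open>w\<close> close to \<open>r\<close> (\<open>approximate_mod_p\<close>). Since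
  \<open>V\<close> contains \<open>R\<close>, this level is still visible after applying \<open>\<pi>\<close>
  (\<open>completed_group_ring_map_quotient_zero\<close>).\<close>

section \<open>Free groups\<close>

lemma inverse_letter_inverse [simp]: "inverse_letter (inverse_letter l) = l"
  by (simp add: inverse_letter_def)

lemma reduced_Nil [simp]: "reduced []"
  by (simp add: reduced_def)

lemma reduced_ConsD: "reduced (l # w) \<Longrightarrow> reduced w"
  by (cases w) (auto simp: reduced_def)

lemma reduced_red_cons: "reduced w \<Longrightarrow> reduced (red_cons l w)"
  by (cases w) (auto simp: reduced_def successively_Cons)

lemma red_cons_reduced: "reduced (l # w) \<Longrightarrow> red_cons l w = l # w"
  by (cases w) (auto simp: reduced_def)

text \<open>Prepending a letter permutes the reduced words. The group laws of the free group are derived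
  from this action.\<close>

lemma red_cons_inverse: "reduced w \<Longrightarrow> red_cons (inverse_letter l) (red_cons l w) = w"
  by (cases w) (auto intro: red_cons_reduced)

lemma reduced_foldr: "reduced w \<Longrightarrow> reduced (foldr red_cons v w)"
  by (induction v) (auto intro: reduced_red_cons)

lemma foldr_reduced: "reduced v \<Longrightarrow> foldr red_cons v [] = v"
proof (induction v)
  case (Cons l v)
  then show ?case using reduced_ConsD[OF Cons.prems] by (simp add: red_cons_reduced)
qed simp

lemma foldr_red_cons:
  assumes "reduced u" "reduced w"
  shows "foldr red_cons (red_cons l u) w = red_cons l (foldr red_cons u w)"
proof (cases u)
  case (Cons m v)
  then have "reduced v" using assms reduced_ConsD by blast
  then show ?thesis
    using Cons red_cons_inverse[of "foldr red_cons v w" "m"] reduced_foldr[OF assms(2), of v] by auto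
qed simp

lemma foldr_assoc:
  assumes "reduced v" "reduced w"
  shows "foldr red_cons (foldr red_cons u v) w = foldr red_cons u (foldr red_cons v w)"
  using assms by (induction u) (auto simp: foldr_red_cons reduced_foldr)

lemma set_red_cons: "set (red_cons l w) \<subseteq> insert l (set w)"
  by (cases w) auto

lemma set_foldr: "set (foldr red_cons v w) \<subseteq> set v \<union> set w"
proof (induction v)
  case (Cons l v)
  then show ?case using set_red_cons[of l "foldr red_cons v w"] by auto
qed simp

lemma foldr_left_inverse:
  "reduced w \<Longrightarrow> foldr red_cons (rev (map inverse_letter v)) (foldr red_cons v w) = w"
proof (induction v arbitrary: w)
  case (Cons l v)
  then show ?case by (simp add: red_cons_inverse reduced_foldr)
qed simp

lemma free_group_simps:
  "w \<in> carrier (free_group n) \<longleftrightarrow> set w \<subseteq> {1..n} \<times> UNIV \<and> reduced w"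
  "v \<otimes>\<^bsub>free_group n\<^esub> w = foldr red_cons v w"
  "\<one>\<^bsub>free_group n\<^esub> = []"
  by (simp_all add: free_group_def)

context
  notes free_group_simps [simp]
begin

lemma group_free_group: "group (free_group n)"
proof (rule groupI)
  fix v w u assume "v \<in> carrier (free_group n)" "w \<in> carrier (free_group n)"
  then show "v \<otimes>\<^bsub>free_group n\<^esub> w \<in> carrier (free_group n)"
    using set_foldr[of v w] by (auto simp: reduced_foldr)
  assume "u \<in> carrier (free_group n)"
  then show "v \<otimes>\<^bsub>free_group n\<^esub> w \<otimes>\<^bsub>free_group n\<^esub> u =
    v \<otimes>\<^bsub>free_group n\<^esub> (w \<otimes>\<^bsub>free_group n\<^esub> u)"
    using \<open>w \<in> _\<close> by (simp add: foldr_assoc)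
next
  fix w assume w: "w \<in> carrier (free_group n)"
  define v where "v = foldr red_cons (rev (map inverse_letter w)) []"
  have "set v \<subseteq> inverse_letter ` set w"
    using set_foldr[of "rev (map inverse_letter w)" "[]"] by (simp add: v_def)
  moreover have "inverse_letter ` set w \<subseteq> {1..n} \<times> UNIV"
    using w by (auto simp: inverse_letter_def)
  ultimately have "v \<in> carrier (free_group n)" by (simp add: v_def reduced_foldr)
  moreover have "foldr red_cons v w = []"
    using foldr_assoc[of "[]" w "rev (map inverse_letter w)"] w foldr_left_inverse[of "[]" w]
    by (simp add: v_def foldr_reduced)
  ultimately show "\<exists>v\<in>carrier (free_group n). v \<otimes>\<^bsub>free_group n\<^esub> w = \<one>\<^bsub>free_group n\<^esub>" by auto
qed auto

text \<open>List induction splits off the head of a reduced word as a left factor; this is the form in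
  which Fox derivatives are computed from right to left.\<close>

lemma free_group_induct [consumes 1, case_names one gen inv_gen]:
  assumes w: "w \<in> carrier (free_group n)"
    and one: "P \<one>\<^bsub>free_group n\<^esub>"
    and gen: "\<And>j w. j \<in> {1..n} \<Longrightarrow> w \<in> carrier (free_group n) \<Longrightarrow> P w \<Longrightarrow>
            P (free_gen j \<otimes>\<^bsub>free_group n\<^esub> w)"
    and inv_gen: "\<And>j w. j \<in> {1..n} \<Longrightarrow> w \<in> carrier (free_group n) \<Longrightarrow> P w \<Longrightarrow>
            P (inv\<^bsub>free_group n\<^esub> free_gen j \<otimes>\<^bsub>free_group n\<^esub> w)"
  shows "P w"
  using w
proof (induction w)
  case (Cons l w)
  interpret group "free_group n" by (rule group_free_group)
  obtain j b where l: "l = (j, b)" by (cases l)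
  have j: "j \<in> {1..n}" and w: "w \<in> carrier (free_group n)"
    using Cons.prems l by (auto dest: reduced_ConsD)
  have "inv\<^bsub>free_group n\<^esub> [(j, True)] = [(j, False)]"
    by (rule inv_equality) (use j in \<open>auto simp: inverse_letter_def reduced_def\<close>)
  moreover have "red_cons l w = l # w" using Cons.prems by (intro red_cons_reduced) simp
  ultimately show ?case
    using gen[OF j w Cons.IH[OF w]] inv_gen[OF j w Cons.IH[OF w]] l
    by (cases b) (auto simp: free_gen_def)
qed (use one in simp)

end

lemma free_gen_closed: "j \<in> {1..n} \<Longrightarrow> free_gen j \<in> carrier (free_group n)"
  by (simp add: free_group_simps free_gen_def reduced_def)

section \<open>Quotient groups and finite $p$-groups\<close>

lemma (in group) rcos_eq_iff:
  assumes "subgroup N G" "x \<in> carrier G" "y \<in> carrier G"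
  shows "N #> x = N #> y \<longleftrightarrow> x \<otimes> inv y \<in> N"
proof
  assume "N #> x = N #> y"
  then have "x \<in> N #> y" using rcos_self[OF assms(2,1)] by simp
  then show "x \<otimes> inv y \<in> N" by (meson assms is_group subgroup.rcos_module_imp)
next
  assume "x \<otimes> inv y \<in> N"
  then have "x \<in> N #> y" by (meson assms is_group subgroup.rcos_module_rev)
  then show "N #> x = N #> y" by (metis repr_independence assms(1,3))
qed

lemma (in group) rcos_eq_self_iff:
  assumes "subgroup N G" "x \<in> carrier G"
  shows "N #> x = N \<longleftrightarrow> x \<in> N"
  by (meson assms coset_join1 coset_join2 subgroup.subset)

lemma (in group) subgroup_mult_rcos:
  assumes "subgroup M G" "subgroup N G" "M \<subseteq> N" "x \<in> carrier G"
  shows "N <#> (M #> x) = N #> x"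
proof -
  have N: "N \<subseteq> carrier G" and M: "M \<subseteq> carrier G" using assms subgroup.subset by auto
  have "N <#> M = N"
  proof
    show "N <#> M \<subseteq> N" using assms by (auto simp: set_mult_def subgroup.m_closed)
    have "y = y \<otimes> \<one>" if "y \<in> N" for y using that N by auto
    then show "N \<subseteq> N <#> M" using subgroup.one_closed[OF assms(1)] unfolding set_mult_def by blast
  qed
  then show ?thesis using setmult_rcos_assoc[OF N M assms(4)] by simp
qed

lemma (in group_hom) order_Mod_kernel: "order (G Mod kernel G H h) = card (h ` carrier G)"
proof -
  let ?I = "H\<lparr>carrier := h ` carrier G\<rparr>"
  have "group ?I" using H.subgroup_imp_group img_is_subgroup by blast
  then have "group_hom G ?I h"
    by (auto intro!: group_hom.intro simp: group_hom_axioms_def hom_def)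
  from group_hom.FactGroup_iso_set[OF this] have "(\<lambda>Y. the_elem (h ` Y)) \<in> iso (G Mod kernel G ?I h) ?I"
    by simp
  then have "order (G Mod kernel G ?I h) = order ?I"
    by (intro iso_same_order) (auto simp: is_iso_def)
  then show ?thesis by (simp add: order_def kernel_def)
qed

text \<open>The factor \<open>c\<close> is the order of the kernel of \<open>G/M \<rightarrow> G/N\<close>.\<close>

lemma (in group) order_Mod_supgroup:
  assumes M: "M \<lhd> G" and N: "N \<lhd> G" and "M \<subseteq> N"
  obtains c where "order (G Mod M) = order (G Mod N) * c"
    and "order (G Mod M) > 0 \<Longrightarrow> M \<noteq> N \<Longrightarrow> c > 1"
proof -
  interpret M: normal M G by (rule M)
  interpret N: normal N G by (rule N)
  interpret Q: group "G Mod M" by (rule M.factorgroup_is_group)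
  interpret Q': group "G Mod N" by (rule N.factorgroup_is_group)
  have val: "N <#> (M #> x) = N #> x" if "x \<in> carrier G" for x
    using subgroup_mult_rcos[OF M.subgroup_axioms N.subgroup_axioms \<open>M \<subseteq> N\<close> that] .
  interpret h: group_hom "G Mod M" "G Mod N" "(<#>) N"
  proof
    show "((<#>) N) \<in> hom (G Mod M) (G Mod N)"
      by (auto simp: hom_def carrier_FactGroup val M.rcos_sum N.rcos_sum)
  qed
  have surj: "((<#>) N) ` carrier (G Mod M) = carrier (G Mod N)"
    by (auto simp: carrier_FactGroup val image_image)
  let ?K = "kernel (G Mod M) (G Mod N) ((<#>) N)"
  have "order (G Mod M) = order ((G Mod M) Mod ?K) * card ?K"
    using Q.lagrange[OF h.subgroup_kernel] by (simp add: order_def FactGroup_def)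
  also have "order ((G Mod M) Mod ?K) = order (G Mod N)"
    unfolding h.order_Mod_kernel surj by (simp add: order_def)
  finally have eq: "order (G Mod M) = order (G Mod N) * card ?K" .
  have "card ?K > 1" if pos: "order (G Mod M) > 0" and ne: "M \<noteq> N"
  proof -
    obtain x where x: "x \<in> N" "x \<notin> M" using ne \<open>M \<subseteq> N\<close> by auto
    then have xG: "x \<in> carrier G" by auto
    have "M \<in> ?K" using h.hom_one Q.one_closed by (auto simp: kernel_def)
    moreover have "M #> x \<in> ?K"
      using x xG val by (auto simp: kernel_def carrier_FactGroup rcos_eq_self_iff N.subgroup_axioms)
    moreover have "M #> x \<noteq> M" using x xG rcos_eq_self_iff M.subgroup_axioms by blast
    moreover have "finite ?K"
      using pos unfolding order_def kernel_def by (auto simp: card_gt_0_iff)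
    ultimately show ?thesis
      using card_le_Suc0_iff_eq[of ?K] by (metis One_nat_def not_le_imp_less)
  qed
  then show thesis by (rule that[OF eq])
qed

lemma (in group_hom) subgroup_preimage:
  assumes "subgroup K H"
  shows "subgroup {g \<in> carrier G. h g \<in> K} G"
proof -
  interpret K: subgroup K H by (rule assms)
  show ?thesis by (rule G.subgroupI) auto
qed

lemma (in group_hom) normal_preimage:
  assumes "K \<lhd> H"
  shows "{g \<in> carrier G. h g \<in> K} \<lhd> G"
proof (rule G.normal_invI[OF subgroup_preimage[OF normal_imp_subgroup[OF assms]]])
  fix x g assume "x \<in> carrier G" "g \<in> {g \<in> carrier G. h g \<in> K}"
  then show "x \<otimes> g \<otimes> inv x \<in> {g \<in> carrier G. h g \<in> K}"
    using normal.inv_op_closed2[OF assms] by simp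
qed

text \<open>Class equation: if the center were trivial, then all conjugacy classes except \<open>{\<one>}\<close> would
  have a size divisible by \<open>p\<close>, and so would the group.\<close>

lemma (in group) p_group_center:
  assumes p: "Factorial_Ring.prime p" and ord: "order G = p ^ k" and k: "order G > 1"
  obtains (center) z where "z \<in> carrier G" "z \<noteq> \<one>" "\<And>x. x \<in> carrier G \<Longrightarrow> x \<otimes> z \<otimes> inv x = z"
proof (rule ccontr)
  assume none: "\<not> thesis"
  define \<phi> where "\<phi> = (\<lambda>g. \<lambda>h \<in> carrier G. g \<otimes> h \<otimes> inv g)"
  have \<phi>: "\<phi> g h = g \<otimes> h \<otimes> inv g" if "h \<in> carrier G" for g h
    using that by (simp add: \<phi>_def)
  interpret act: group_action G "carrier G" \<phi> unfolding \<phi>_def by (rule action_by_conjugation)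
  let ?O = "orbits G (carrier G) \<phi>"
  have fin: "finite (carrier G)" using k order_gt_0_iff_finite by simp
  have sub: "b \<subseteq> carrier G" if "b \<in> ?O" for b
    using that act.element_image by (auto simp: orbits_def orbit_def)
  have one: "orbit G \<phi> \<one> = {\<one>}"
  proof -
    have "\<phi> g \<one> = \<one>" if "g \<in> carrier G" for g using that \<phi> by simp
    then have "orbit G \<phi> \<one> \<subseteq> {\<one>}" unfolding orbit_def by blast
    then show ?thesis using act.orbit_refl[OF one_closed] by blast
  qed
  have div: "p dvd card b" if b: "b \<in> ?O" "b \<noteq> {\<one>}" for b
  proof -
    obtain x where x: "x \<in> carrier G" "b = orbit G \<phi> x" using b(1) by (auto simp: orbits_def)
    have "card b dvd p ^ k"
      unfolding x(2) ord[symmetric] by (rule dvdI[OF act.orbit_stabilizer_theorem[OF x(1), symmetric]])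
    then obtain j where j: "card b = p ^ j" using divides_primepow_nat[OF p] by blast
    have "j \<noteq> 0"
    proof
      assume "j = 0"
      then obtain y where y: "b = {y}" using j card_1_singletonE by auto
      have "x \<in> b" unfolding x(2) by (rule act.orbit_refl[OF x(1)])
      then have "b = {x}" using y by simp
      moreover have "g \<otimes> x \<otimes> inv g \<in> b" if "g \<in> carrier G" for g
        using that x \<phi>[OF x(1), of g] by (auto simp: orbit_def)
      ultimately have "x = \<one>" using none center[OF x(1)] by blast
      then show False using b(2) x(2) one by simp
    qed
    then show ?thesis using j by (cases j) auto
  qed
  have mem: "{\<one>} \<in> ?O" using one by (auto simp: orbits_def)
  have "(\<Sum>b\<in>?O. card b) = (\<Sum>b\<in>?O. \<Sum>a\<in>b. 1)" by simp
  also have "\<dots> = (\<Sum>a\<in>carrier G. 1)"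
    by (rule partition.disjoint_sum[OF act.orbit_partition fin])
  also have "\<dots> = p ^ k" using ord by (simp add: order_def)
  finally have eq: "(\<Sum>b\<in>?O. card b) = p ^ k" .
  have "finite ?O" using fin sub by (meson PowI finite_Pow_iff finite_subset subsetI)
  then have "(\<Sum>b\<in>?O. card b) = 1 + (\<Sum>b\<in>?O - {{\<one>}}. card b)"
    using sum.remove[OF _ mem, of card] by simp
  moreover have "p dvd (\<Sum>b\<in>?O - {{\<one>}}. card b)" using div by (intro dvd_sum) auto
  moreover have "p dvd p ^ k" using k ord by (cases k) auto
  ultimately have "p dvd 1"
    using eq dvd_add_left_iff[of p "\<Sum>b\<in>?O - {{\<one>}}. card b" 1] by simp
  then show False using p by (simp add: prime_nat_iff)
qed

lemma (in group) p_group_central_order_p: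
  assumes p: "Factorial_Ring.prime p" and ord: "order G = p ^ k" and k: "order G > 1"
  obtains z where "z \<in> carrier G" "z \<noteq> \<one>" "z [^] p = \<one>" "\<And>x. x \<in> carrier G \<Longrightarrow> x \<otimes> z = z \<otimes> x"
proof -
  obtain z where z: "z \<in> carrier G" "z \<noteq> \<one>" "\<And>x. x \<in> carrier G \<Longrightarrow> x \<otimes> z \<otimes> inv x = z"
    using p_group_center[OF assms] by blast
  have comm: "z \<otimes> x = x \<otimes> z" if "x \<in> carrier G" for x
    using z(3)[OF that] that z(1) by (metis inv_solve_right m_closed)
  have fin: "finite (carrier G)" using k order_gt_0_iff_finite by simp
  have "ord z dvd p ^ k" using ord_dvd_group_order[OF z(1)] ord by simp
  then obtain j where j: "ord z = p ^ j" using divides_primepow_nat[OF p] by blast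
  have "j \<noteq> 0" using z ord_eq_1[OF z(1)] j by auto
  then obtain i where i: "j = Suc i" by (cases j) auto
  let ?y = "z [^] (p ^ i)"
  have "\<not> p ^ Suc i dvd p ^ i" using prime_gt_1_nat[OF p] by (auto dest!: dvd_imp_le)
  then have "?y \<noteq> \<one>" using pow_eq_id[OF z(1)] j i by simp
  moreover have "?y [^] p = \<one>"
    using pow_ord_eq_1[OF z(1)] j i z(1) by (simp add: nat_pow_pow mult.commute)
  moreover have "x \<otimes> ?y = ?y \<otimes> x" if "x \<in> carrier G" for x
    using group_commutes_pow[OF comm[OF that] z(1) that] by simp
  ultimately show thesis using that[of ?y] z(1) by simp
qed

lemma (in group) central_int_pow:
  fixes i :: int
  assumes z: "z \<in> carrier G" "\<And>x. x \<in> carrier G \<Longrightarrow> x \<otimes> z = z \<otimes> x" and x: "x \<in> carrier G"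
  shows "x \<otimes> z [^] i = z [^] i \<otimes> x"
proof -
  have "inv z \<otimes> x = x \<otimes> inv z"
  proof -
    have "inv z \<otimes> x = inv z \<otimes> (x \<otimes> z) \<otimes> inv z" using z(1) x by (simp add: m_assoc)
    also have "\<dots> = inv z \<otimes> (z \<otimes> x) \<otimes> inv z" using z(2)[OF x] by simp
    also have "\<dots> = (inv z \<otimes> z) \<otimes> x \<otimes> inv z" using z(1) x by (simp only: m_assoc inv_closed m_closed)
    finally show ?thesis using z(1) x by simp
  qed
  then have "inv z [^] n \<otimes> x = x \<otimes> inv z [^] n" for n :: nat
    by (rule group_commutes_pow[OF _ inv_closed[OF z(1)] x])
  moreover have "z [^] n \<otimes> x = x \<otimes> z [^] n" for n :: nat
    using group_commutes_pow[OF z(2)[OF x, symmetric] z(1) x] .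
  moreover have "z [^] i = inv z [^] nat (- i) \<or> z [^] i = z [^] nat i"
    by (cases "i < 0") (simp_all only: int_pow_def2 nat_pow_inv[OF z(1)] if_True if_False simp_thms)
  ultimately show ?thesis by auto
qed

lemma (in group) normal_central_powers:
  assumes z: "z \<in> carrier G" "\<And>x. x \<in> carrier G \<Longrightarrow> x \<otimes> z = z \<otimes> x"
  shows "range (\<lambda>i::int. z [^] i) \<lhd> G"
proof (rule normal_invI[OF subgroup_of_powers[OF z(1)]])
  fix x y assume x: "x \<in> carrier G" and "y \<in> range (\<lambda>i::int. z [^] i)"
  then obtain i :: int where y: "y = z [^] i" by blast
  have "x \<otimes> y \<otimes> inv x = y \<otimes> (x \<otimes> inv x)"
    using x z(1) by (simp add: y central_int_pow[OF z x] m_assoc del: r_inv)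
  then have "x \<otimes> y \<otimes> inv x = y" using x z(1) y by simp
  then show "x \<otimes> y \<otimes> inv x \<in> range (\<lambda>i::int. z [^] i)" using y by simp
qed

lemma (in group) int_pow_pow_eq_one:
  fixes i :: int
  assumes z: "z \<in> carrier G" "z [^] (p::nat) = \<one>"
  shows "(z [^] i) [^] p = \<one>"
proof -
  have "(z [^] i) [^] p = (z [^] i) [^] int p" by (simp only: int_pow_int)
  also have "\<dots> = (z [^] int p) [^] i" by (simp only: int_pow_pow[OF z(1)] mult.commute)
  also have "\<dots> = \<one>" by (simp only: int_pow_int z(2) int_pow_one)
  finally show ?thesis .
qed

section \<open>The pro-$p$ completion as a compact group\<close>

lemma hull_subset_closed_normal:
  "A \<subseteq> closed_normal_subgroup_generated Q T A"
  "K \<lhd> Q \<Longrightarrow> closedin T K \<Longrightarrow> A \<subseteq> K \<Longrightarrow> closed_normal_subgroup_generated Q T A \<subseteq> K"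
  unfolding closed_normal_subgroup_generated_def by (rule hull_subset, rule hull_minimal) auto

locale pro_p_setting = group G for G (structure) +
  fixes p :: nat
  assumes prime_p: "Factorial_Ring.prime p"
begin

abbreviation \<N> where "\<N> \<equiv> p_power_index_normal p G"
abbreviation Q where "Q \<equiv> pro_p_completion p G"
abbreviation T where "T \<equiv> pro_p_topology p G"

lemma \<N>D:
  assumes "N \<in> \<N>"
  shows "N \<lhd> G" "subgroup N G" "order (G Mod N) > 0" "finite (carrier (G Mod N))"
proof -
  show "N \<lhd> G" using assms by (simp add: p_power_index_normal_def)
  then show "subgroup N G" by (rule normal_imp_subgroup)
  show "order (G Mod N) > 0"
    using assms prime_gt_0_nat[OF prime_p] by (auto simp: p_power_index_normal_def)
  then show "finite (carrier (G Mod N))" by (simp add: order_def card_gt_0_iff)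
qed

lemma \<N>_supgroup:
  assumes "M \<in> \<N>" "N \<lhd> G" "M \<subseteq> N"
  shows "N \<in> \<N>" and "M \<noteq> N \<Longrightarrow> order (G Mod N) < order (G Mod M)"
proof -
  obtain c where c: "order (G Mod M) = order (G Mod N) * c"
      "order (G Mod M) > 0 \<Longrightarrow> M \<noteq> N \<Longrightarrow> c > 1"
    using order_Mod_supgroup[OF \<N>D(1)[OF assms(1)] assms(2,3)] by blast
  obtain k where k: "order (G Mod M) = p ^ k" using assms(1) by (auto simp: p_power_index_normal_def)
  have "order (G Mod N) dvd p ^ k" using c(1) k by simp
  then obtain j where "order (G Mod N) = p ^ j" using divides_primepow_nat[OF prime_p] by blast
  then show "N \<in> \<N>" using assms(2) by (auto simp: p_power_index_normal_def)
  show "M \<noteq> N \<Longrightarrow> order (G Mod N) < order (G Mod M)"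
    using c \<N>D(3)[OF assms(1)] by simp
qed

text \<open>The quotient \<open>G/(M \<inter> N)\<close> embeds into \<open>G/M \<times> G/N\<close>.\<close>

lemma \<N>_Int:
  assumes "M \<in> \<N>" "N \<in> \<N>"
  shows "M \<inter> N \<in> \<N>"
proof -
  interpret M: normal M G by (rule \<N>D(1)[OF assms(1)])
  interpret N: normal N G by (rule \<N>D(1)[OF assms(2)])
  let ?D = "(G Mod M) \<times>\<times> (G Mod N)"
  have D: "group ?D" using M.factorgroup_is_group N.factorgroup_is_group by (rule DirProd_group)
  interpret h: group_hom G ?D "\<lambda>x. (M #> x, N #> x)"
    by (intro group_hom.intro is_group D group_hom_axioms.intro iffD2[OF hom_paired] conjI
        M.r_coset_hom_Mod N.r_coset_hom_Mod)
  have "kernel G ?D (\<lambda>x. (M #> x, N #> x)) = M \<inter> N"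
    using rcos_eq_self_iff[OF M.subgroup_axioms] rcos_eq_self_iff[OF N.subgroup_axioms] M.subset
    unfolding kernel_def by auto
  then have card: "order (G Mod (M \<inter> N)) = card ((\<lambda>x. (M #> x, N #> x)) ` carrier G)"
    using h.order_Mod_kernel by simp
  obtain a b where ab: "order (G Mod M) = p ^ a" "order (G Mod N) = p ^ b"
    using assms by (auto simp: p_power_index_normal_def)
  have "card ((\<lambda>x. (M #> x, N #> x)) ` carrier G) dvd order ?D"
    unfolding group.lagrange[OF D h.img_is_subgroup, symmetric] by simp
  also have "order ?D = p ^ (a + b)"
    using ab by (simp add: order_def DirProd_def card_cartesian_product power_add)
  finally obtain j where "order (G Mod (M \<inter> N)) = p ^ j"
    using divides_primepow_nat[OF prime_p] card by auto
  then show ?thesis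
    using normal_subgroup_intersect[OF M.normal_axioms N.normal_axioms]
    by (auto simp: p_power_index_normal_def)
qed

lemma carrier_in_\<N>: "carrier G \<in> \<N>"
proof -
  have "order (G Mod carrier G) = p ^ 0"
    using rcos_eq_self_iff[OF subgroup_self] carrier_FactGroup[of G "carrier G"]
    by (auto simp: order_def image_constant_conv cong: image_cong)
  then show ?thesis using normal_self unfolding p_power_index_normal_def by blast
qed

lemma \<N>_finite_Int: "finite J \<Longrightarrow> J \<subseteq> \<N> \<Longrightarrow> \<exists>M\<in>\<N>. \<forall>N\<in>J. M \<subseteq> N"
proof (induction J rule: finite_induct)
  case empty
  then show ?case using carrier_in_\<N> by blast
next
  case (insert N J)
  then obtain M where "M \<in> \<N>" "\<forall>N\<in>J. M \<subseteq> N" by auto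
  then show ?case using \<N>_Int[of M N] insert.prems by (intro bexI[of _ "M \<inter> N"]) auto
qed

lemma carrier_Q:
  "carrier Q = {f. f \<in> (\<Pi>\<^sub>E N\<in>\<N>. carrier (G Mod N)) \<and>
     (\<forall>M\<in>\<N>. \<forall>N\<in>\<N>. M \<subseteq> N \<longrightarrow> f N = N <#> f M)}"
  by (simp add: pro_p_completion_def)

lemma Q_coherent:
  assumes "f \<in> carrier Q" "M \<in> \<N>" "N \<in> \<N>" "M \<subseteq> N"
  shows "f N = N <#> f M"
proof -
  have "\<forall>M\<in>\<N>. \<forall>N\<in>\<N>. M \<subseteq> N \<longrightarrow> f N = N <#> f M"
    using assms(1) unfolding carrier_Q by blast
  then show ?thesis using assms by blast
qed

lemma Q_PiE: "f \<in> carrier Q \<Longrightarrow> f \<in> (\<Pi>\<^sub>E N\<in>\<N>. carrier (G Mod N))"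
  unfolding carrier_Q by blast

lemma Q_mem_Mod: "f \<in> carrier Q \<Longrightarrow> N \<in> \<N> \<Longrightarrow> f N \<in> carrier (G Mod N)"
  using Q_PiE by blast

lemma Q_coset:
  assumes "f \<in> carrier Q" "N \<in> \<N>"
  obtains x where "x \<in> carrier G" "f N = N #> x"
  using Q_mem_Mod[OF assms] by (auto simp: carrier_FactGroup)

lemma Q_coherent_rcos:
  assumes "f \<in> carrier Q" "M \<in> \<N>" "N \<in> \<N>" "M \<subseteq> N" "x \<in> carrier G" "f M = M #> x"
  shows "f N = N #> x"
  using Q_coherent[OF assms(1-4)] assms subgroup_mult_rcos \<N>D(2) by simp

lemma Q_carrierI:
  assumes "f \<in> (\<Pi>\<^sub>E N\<in>\<N>. carrier (G Mod N))"
    and "\<And>M N. M \<in> \<N> \<Longrightarrow> N \<in> \<N> \<Longrightarrow> M \<subseteq> N \<Longrightarrow> f N = N <#> f M"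
  shows "f \<in> carrier Q"
  unfolding carrier_Q using assms by blast

lemma Q_eqI:
  assumes "f \<in> carrier Q" "g \<in> carrier Q" "\<And>N. N \<in> \<N> \<Longrightarrow> f N = g N"
  shows "f = g"
  using PiE_ext[OF Q_PiE[OF assms(1)] Q_PiE[OF assms(2)]] assms(3) by blast

lemma Q_mult_eq: "f \<otimes>\<^bsub>Q\<^esub> g = (\<lambda>N\<in>\<N>. f N <#> g N)"
  by (simp add: pro_p_completion_def)

lemma Q_one_eq: "\<one>\<^bsub>Q\<^esub> = (\<lambda>N\<in>\<N>. N)"
  by (simp add: pro_p_completion_def)

lemma Q_mult: "N \<in> \<N> \<Longrightarrow> (f \<otimes>\<^bsub>Q\<^esub> g) N = f N <#> g N"
  by (simp add: pro_p_completion_def)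

lemma Q_one: "N \<in> \<N> \<Longrightarrow> \<one>\<^bsub>Q\<^esub> N = N"
  by (simp add: pro_p_completion_def)

lemma completion_map_apply: "N \<in> \<N> \<Longrightarrow> completion_map p G x N = N #> x"
  by (simp add: completion_map_def)

lemma completion_map_closed:
  assumes "x \<in> carrier G"
  shows "completion_map p G x \<in> carrier Q"
  using assms subgroup_mult_rcos \<N>D(2)
  by (auto simp: pro_p_completion_def completion_map_def carrier_FactGroup)

lemma Q_inverse_ex:
  assumes f: "f \<in> carrier Q"
  shows "\<exists>g\<in>carrier Q. g \<otimes>\<^bsub>Q\<^esub> f = \<one>\<^bsub>Q\<^esub>"
proof -
  define g where "g = (\<lambda>N\<in>\<N>. inv\<^bsub>G Mod N\<^esub> (f N))"
  have g: "g N = N #> inv x" if "N \<in> \<N>" "x \<in> carrier G" "f N = N #> x" for N x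
  proof -
    interpret N: normal N G by (rule \<N>D(1)[OF that(1)])
    have "inv\<^bsub>G Mod N\<^esub> (f N) = set_inv (N #> x)"
      using N.inv_FactGroup[of "f N"] that by (simp add: carrier_FactGroup)
    then show ?thesis using that N.rcos_inv by (simp add: g_def)
  qed
  have "g \<in> carrier Q"
  proof -
    have "g N \<in> carrier (G Mod N)" if "N \<in> \<N>" for N
      using Q_coset[OF f that] g[OF that] by (metis carrier_FactGroup imageI inv_closed)
    then have "g \<in> (\<Pi>\<^sub>E N\<in>\<N>. carrier (G Mod N))" by (simp add: PiE_iff g_def)
    moreover have "g N = N <#> g M" if MN: "M \<in> \<N>" "N \<in> \<N>" "M \<subseteq> N" for M N
    proof -
      obtain x where x: "x \<in> carrier G" "f M = M #> x" using Q_coset[OF f MN(1)] .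
      then have "f N = N #> x" using Q_coherent_rcos[OF f MN] by simp
      then show ?thesis using g x MN subgroup_mult_rcos[of M N "inv x"] \<N>D(2) by simp
    qed
    ultimately show ?thesis by (rule Q_carrierI)
  qed
  moreover have "g \<otimes>\<^bsub>Q\<^esub> f = \<one>\<^bsub>Q\<^esub>"
  proof -
    have "g N <#> f N = N" if N: "N \<in> \<N>" for N
    proof -
      interpret N: normal N G by (rule \<N>D(1)[OF N])
      obtain x where x: "x \<in> carrier G" "f N = N #> x" using Q_coset[OF f N] .
      then show ?thesis using g[OF N x] N.rcos_sum N.subset by simp
    qed
    then show ?thesis unfolding Q_mult_eq Q_one_eq by (rule restrict_ext)
  qed
  ultimately show ?thesis by blast
qed

lemma group_Q: "group Q"
proof (rule groupI)
  fix f g h assume f: "f \<in> carrier Q" and g: "g \<in> carrier Q"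
  have mult: "f N <#> g N = N #> (x \<otimes> y)"
    if "N \<in> \<N>" "x \<in> carrier G" "y \<in> carrier G" "f N = N #> x" "g N = N #> y" for N x y
    using normal.rcos_sum[OF \<N>D(1)[OF that(1)]] that by simp
  show "f \<otimes>\<^bsub>Q\<^esub> g \<in> carrier Q"
  proof -
    have "f N <#> g N \<in> carrier (G Mod N)" if N: "N \<in> \<N>" for N
    proof -
      obtain x y where "x \<in> carrier G" "f N = N #> x" "y \<in> carrier G" "g N = N #> y"
        using Q_coset[OF f N] Q_coset[OF g N] by metis
      then show ?thesis using mult[OF N] by (simp add: carrier_FactGroup)
    qed
    then have "f \<otimes>\<^bsub>Q\<^esub> g \<in> (\<Pi>\<^sub>E N\<in>\<N>. carrier (G Mod N))" by (simp add: PiE_iff Q_mult_eq)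
    moreover have "(f \<otimes>\<^bsub>Q\<^esub> g) N = N <#> (f \<otimes>\<^bsub>Q\<^esub> g) M" if MN: "M \<in> \<N>" "N \<in> \<N>" "M \<subseteq> N" for M N
    proof -
      obtain x y where xy: "x \<in> carrier G" "f M = M #> x" "y \<in> carrier G" "g M = M #> y"
        using Q_coset[OF f MN(1)] Q_coset[OF g MN(1)] by metis
      then have "f N = N #> x" "g N = N #> y"
        using Q_coherent_rcos[OF f MN] Q_coherent_rcos[OF g MN] by blast+
      then show ?thesis
        using mult xy MN subgroup_mult_rcos[of M N "x \<otimes> y"] \<N>D(2) by (simp add: Q_mult_eq)
    qed
    ultimately show ?thesis by (rule Q_carrierI)
  qed
  assume h: "h \<in> carrier Q"
  have "f N <#> g N <#> h N = f N <#> (g N <#> h N)" if N: "N \<in> \<N>" for N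
    using Q_mem_Mod[OF f N] Q_mem_Mod[OF g N] Q_mem_Mod[OF h N]
      normal.rcosets_assoc[OF \<N>D(1)[OF N]] by (simp add: FactGroup_def)
  then show "f \<otimes>\<^bsub>Q\<^esub> g \<otimes>\<^bsub>Q\<^esub> h = f \<otimes>\<^bsub>Q\<^esub> (g \<otimes>\<^bsub>Q\<^esub> h)"
    unfolding Q_mult_eq by (auto intro!: restrict_ext)
next
  have "completion_map p G \<one> = \<one>\<^bsub>Q\<^esub>"
    using \<N>D(2) subgroup.subset by (fastforce simp: completion_map_def pro_p_completion_def)
  then show "\<one>\<^bsub>Q\<^esub> \<in> carrier Q" using completion_map_closed[OF one_closed] by simp
next
  fix f assume f: "f \<in> carrier Q"
  then have "N <#> f N = f N" if "N \<in> \<N>" for N using Q_coherent[OF f that that] by simp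
  then show "\<one>\<^bsub>Q\<^esub> \<otimes>\<^bsub>Q\<^esub> f = f"
    using Q_PiE[OF f] unfolding Q_mult_eq Q_one_eq
    by (auto simp: PiE_def extensional_def restrict_def fun_eq_iff)
qed (rule Q_inverse_ex)

sublocale Q: group Q by (rule group_Q)

lemma Q_inv:
  assumes "f \<in> carrier Q" "N \<in> \<N>" "x \<in> carrier G" "f N = N #> x"
  shows "(inv\<^bsub>Q\<^esub> f) N = N #> inv x"
proof -
  interpret N: normal N G by (rule \<N>D(1)[OF assms(2)])
  obtain y where y: "y \<in> carrier G" "(inv\<^bsub>Q\<^esub> f) N = N #> y"
    using Q_coset[OF Q.inv_closed[OF assms(1)] assms(2)] .
  have "N #> (y \<otimes> x) = N"
    using Q_mult[OF assms(2), of "inv\<^bsub>Q\<^esub> f" f] assms y Q.l_inv N.rcos_sum Q_one by simp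
  then have "y \<otimes> inv (inv x) \<in> N"
    using y assms(3) rcos_eq_self_iff N.subgroup_axioms by simp
  then show ?thesis using y assms(3) rcos_eq_iff[OF N.subgroup_axioms] by simp
qed

lemma Q_eq_iff:
  assumes "f \<in> carrier Q" "g \<in> carrier Q" "N \<in> \<N>"
  shows "f N = g N \<longleftrightarrow> (f \<otimes>\<^bsub>Q\<^esub> inv\<^bsub>Q\<^esub> g) N = N"
proof -
  interpret N: normal N G by (rule \<N>D(1)[OF assms(3)])
  obtain x y where "x \<in> carrier G" "f N = N #> x" "y \<in> carrier G" "g N = N #> y"
    using Q_coset assms by metis
  then show ?thesis
    using Q_mult[OF assms(3)] Q_inv[OF assms(2,3)] N.rcos_sum rcos_eq_self_iff[OF N.subgroup_axioms]
      rcos_eq_iff[OF N.subgroup_axioms] by simp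
qed

lemma completion_map_mult:
  assumes "x \<in> carrier G" "y \<in> carrier G"
  shows "completion_map p G (x \<otimes> y) = completion_map p G x \<otimes>\<^bsub>Q\<^esub> completion_map p G y"
  using assms normal.rcos_sum[OF \<N>D(1)] unfolding completion_map_def Q_mult_eq
  by (auto intro!: restrict_ext)

lemma completion_map_hom: "group_hom G Q (completion_map p G)"
  using completion_map_closed completion_map_mult
  by (intro group_hom.intro is_group group_Q group_hom_axioms.intro) (auto simp: hom_def)

lemma carrier_Q_subset_topspace:
  "carrier Q \<subseteq> topspace (product_topology (\<lambda>N. discrete_topology (carrier (G Mod N))) \<N>)"
  using Q_PiE by (auto simp: topspace_product_topology)

lemma topspace_T [simp]: "topspace T = carrier Q"
  using carrier_Q_subset_topspace by (auto simp: pro_p_topology_def topspace_subtopology)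

lemma continuous_component:
  "N \<in> \<N> \<Longrightarrow> continuous_map T (discrete_topology (carrier (G Mod N))) (\<lambda>f. f N)"
  unfolding pro_p_topology_def
  by (intro continuous_map_from_subtopology continuous_map_product_projection)

lemma clopen_component:
  assumes "N \<in> \<N>"
  shows "openin T {f \<in> carrier Q. f N \<in> S}" "closedin T {f \<in> carrier Q. f N \<in> S}"
proof -
  have eq: "{f \<in> carrier Q. f N \<in> S} = {f \<in> topspace T. f N \<in> S \<inter> carrier (G Mod N)}"
    using Q_mem_Mod[OF _ assms] by auto
  show "openin T {f \<in> carrier Q. f N \<in> S}"
    unfolding eq by (rule openin_continuous_map_preimage[OF continuous_component[OF assms]]) simp
  show "closedin T {f \<in> carrier Q. f N \<in> S}"
    unfolding eq by (rule closedin_continuous_map_preimage[OF continuous_component[OF assms]]) simp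
qed

text \<open>A basic open set of the product restricts only finitely many components, and on coherent
  families these are all determined by the component at one smaller subgroup.\<close>

lemma openin_T_basis:
  assumes "openin T S" "f \<in> S"
  obtains N where "N \<in> \<N>" "\<And>g. g \<in> carrier Q \<Longrightarrow> g N = f N \<Longrightarrow> g \<in> S"
proof -
  let ?D = "\<lambda>N. discrete_topology (carrier (G Mod N))"
  obtain O' where O': "openin (product_topology ?D \<N>) O'" "S = O' \<inter> carrier Q"
    using assms(1) by (auto simp: pro_p_topology_def openin_subtopology)
  then have fO: "f \<in> O'" and f: "f \<in> carrier Q" using assms(2) by auto
  obtain U where U: "finite {N \<in> \<N>. U N \<noteq> topspace (?D N)}" "f \<in> Pi\<^sub>E \<N> U" "Pi\<^sub>E \<N> U \<subseteq> O'"
    using O'(1) fO unfolding openin_product_topology_alt by meson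
  obtain M where M: "M \<in> \<N>" "\<forall>N\<in>{N \<in> \<N>. U N \<noteq> topspace (?D N)}. M \<subseteq> N"
    using \<N>_finite_Int[OF U(1)] by blast
  have "g \<in> S" if g: "g \<in> carrier Q" "g M = f M" for g
  proof -
    have "g N \<in> U N" if N: "N \<in> \<N>" for N
    proof (cases "U N = topspace (?D N)")
      case True
      then show ?thesis using Q_mem_Mod[OF g(1) N] by simp
    next
      case False
      then have "M \<subseteq> N" using M N by blast
      then have "g N = f N" using Q_coherent[OF _ M(1) N] g f by metis
      then show ?thesis using U(2) N by auto
    qed
    then have "g \<in> Pi\<^sub>E \<N> U" using Q_PiE[OF g(1)] by (auto simp: PiE_iff)
    then show ?thesis using U(3) O'(2) g(1) by blast
  qed
  then show thesis by (rule that[OF M(1)])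
qed

text \<open>The coherent families form a closed subset of a product of finite discrete spaces.\<close>

lemma compact_T: "compact_space T"
proof -
  let ?X = "product_topology (\<lambda>N. discrete_topology (carrier (G Mod N))) \<N>"
  have "closedin ?X (carrier Q)"
  proof -
    define E where "E = (\<lambda>(M, N). {f \<in> topspace ?X. f N = N <#> f M})"
    have "closedin ?X (E (M, N))" if MN: "M \<in> \<N>" "N \<in> \<N>" "M \<subseteq> N" for M N
    proof -
      have "continuous_map ?X (discrete_topology (carrier (G Mod N))) (\<lambda>f. f N)"
        using MN by (intro continuous_map_product_projection)
      moreover have "continuous_map ?X (discrete_topology (carrier (G Mod N))) ((<#>) N \<circ> (\<lambda>f. f M))"
      proof (rule continuous_map_compose)
        show "continuous_map ?X (discrete_topology (carrier (G Mod M))) (\<lambda>f. f M)"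
          using MN by (intro continuous_map_product_projection)
        show "continuous_map (discrete_topology (carrier (G Mod M))) (discrete_topology (carrier (G Mod N))) ((<#>) N)"
          using subgroup_mult_rcos[OF \<N>D(2)[OF MN(1)] \<N>D(2)[OF MN(2)] MN(3)]
          by (auto simp: carrier_FactGroup)
      qed
      ultimately show ?thesis
        using closedin_continuous_maps_eq[OF Hausdorff_space_discrete_topology] unfolding E_def by fastforce
    qed
    then have "closedin ?X (\<Inter>(E ` {(M, N). M \<in> \<N> \<and> N \<in> \<N> \<and> M \<subseteq> N}))"
      using carrier_in_\<N> by (intro closedin_Inter) auto
    then have "closedin ?X (topspace ?X \<inter> \<Inter>(E ` {(M, N). M \<in> \<N> \<and> N \<in> \<N> \<and> M \<subseteq> N}))"
      by (intro closedin_Int closedin_topspace)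
    moreover have "carrier Q = topspace ?X \<inter> \<Inter>(E ` {(M, N). M \<in> \<N> \<and> N \<in> \<N> \<and> M \<subseteq> N})"
      unfolding carrier_Q E_def by (auto simp: topspace_product_topology)
    ultimately show ?thesis by simp
  qed
  moreover have "compact_space ?X"
    using \<N>D(4) by (simp add: compact_space_product_topology compact_space_discrete_topology)
  ultimately show ?thesis
    unfolding pro_p_topology_def
    by (simp add: closedin_compact_space compact_space_subtopology)
qed

text \<open>The elements of \<open>H\<close> that agree with some element of \<open>R\<close> at \<open>N\<close> but are not trivial at \<open>N1\<close> form
  a closed set, which shrinks with \<open>N\<close>. If all these sets were nonempty, compactness would give a
  common element; it would lie in the closed set \<open>R\<close>, hence in \<open>H \<inter> R\<close>, although it is not trivial.\<close>

lemma separate_closed_sets: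
  assumes H: "closedin T H" and R: "closedin T R" and HR: "H \<inter> R \<subseteq> {\<one>\<^bsub>Q\<^esub>}" and N1: "N1 \<in> \<N>"
  obtains (sep) N where "N \<in> \<N>" "\<And>h g. h \<in> H \<Longrightarrow> g \<in> R \<Longrightarrow> h N = g N \<Longrightarrow> h N1 = N1"
proof (rule ccontr)
  assume none: "\<not> thesis"
  have HQ: "H \<subseteq> carrier Q" and RQ: "R \<subseteq> carrier Q" using H R closedin_subset by fastforce+
  define C where "C N = H \<inter> {f \<in> carrier Q. f N \<in> (\<lambda>g. g N) ` R} \<inter> {f \<in> carrier Q. f N1 \<in> - {N1}}" for N
  have ne: "C N \<noteq> {}" if N: "N \<in> \<N>" for N
  proof -
    obtain h g where hg: "h \<in> H" "g \<in> R" "h N = g N" "h N1 \<noteq> N1"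
      using none sep[OF N] by blast
    then have "h \<in> C N" using HQ unfolding C_def by auto
    then show ?thesis by blast
  qed
  have mono: "C M \<subseteq> C N" if MN: "M \<in> \<N>" "N \<in> \<N>" "M \<subseteq> N" for M N
  proof
    fix f assume f: "f \<in> C M"
    then obtain g where g: "g \<in> R" "f M = g M" unfolding C_def by blast
    have "f \<in> carrier Q" "g \<in> carrier Q" using f g RQ by (auto simp: C_def)
    then have "f N = g N" using Q_coherent[OF _ MN] g(2) by metis
    then show "f \<in> C N" using f g(1) unfolding C_def by blast
  qed
  have "\<Inter>(C ` \<N>) \<noteq> {}"
  proof (rule compact_space_fip[THEN iffD1, OF compact_T, rule_format])
    show "(\<forall>S\<in>C ` \<N>. closedin T S) \<and> (\<forall>\<F>. finite \<F> \<and> \<F> \<subseteq> C ` \<N> \<longrightarrow> \<Inter>\<F> \<noteq> {})"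
    proof (intro conjI ballI allI impI)
      fix S assume "S \<in> C ` \<N>"
      then obtain N where N: "N \<in> \<N>" "S = C N" by blast
      show "closedin T S"
        unfolding N(2) C_def by (intro closedin_Int H clopen_component(2) N(1) N1)
    next
      fix \<F> assume \<F>: "finite \<F> \<and> \<F> \<subseteq> C ` \<N>"
      then obtain J where J: "finite J" "J \<subseteq> \<N>" "\<F> = C ` J" by (meson finite_subset_image)
      obtain M where M: "M \<in> \<N>" "\<forall>N\<in>J. M \<subseteq> N" using \<N>_finite_Int[OF J(1,2)] by blast
      then have "C M \<subseteq> \<Inter>\<F>" using mono J by blast
      then show "\<Inter>\<F> \<noteq> {}" using ne[OF M(1)] by blast
    qed
  qed
  then obtain h where h: "\<And>N. N \<in> \<N> \<Longrightarrow> h \<in> C N" by blast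
  then have hH: "h \<in> H" and hN1: "h N1 \<noteq> N1" using N1 unfolding C_def by auto
  have "h \<in> R"
  proof (rule ccontr)
    assume "h \<notin> R"
    moreover have "openin T (carrier Q - R)" using R by (metis openin_diff openin_topspace topspace_T)
    ultimately obtain N where N: "N \<in> \<N>" "\<And>g. g \<in> carrier Q \<Longrightarrow> g N = h N \<Longrightarrow> g \<in> carrier Q - R"
      using openin_T_basis[of "carrier Q - R" h] hH HQ by blast
    obtain g where "g \<in> R" "h N = g N" using h[OF N(1)] unfolding C_def by blast
    then show False using N(2)[of g] RQ by auto
  qed
  then have "h = \<one>\<^bsub>Q\<^esub>" using hH HR by blast
  then show False using hN1 Q_one[OF N1] by simp
qed

text \<open>An open subgroup contains some \<open>{f. f N = N}\<close>.\<close>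

lemma open_subgroup_component:
  assumes U: "subgroup U Q" "openin T U"
  obtains N where "N \<in> \<N>"
    "\<And>f g. f \<in> carrier Q \<Longrightarrow> g \<in> carrier Q \<Longrightarrow> f N = g N \<Longrightarrow> U #>\<^bsub>Q\<^esub> f = U #>\<^bsub>Q\<^esub> g"
proof -
  obtain N where N: "N \<in> \<N>" "\<And>g. g \<in> carrier Q \<Longrightarrow> g N = \<one>\<^bsub>Q\<^esub> N \<Longrightarrow> g \<in> U"
    using openin_T_basis[OF U(2) subgroup.one_closed[OF U(1)]] by blast
  show thesis
  proof (rule that[OF N(1)])
    fix f g assume fg: "f \<in> carrier Q" "g \<in> carrier Q" "f N = g N"
    then have "(f \<otimes>\<^bsub>Q\<^esub> inv\<^bsub>Q\<^esub> g) N = \<one>\<^bsub>Q\<^esub> N" using Q_eq_iff N(1) Q_one by simp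
    then have "f \<otimes>\<^bsub>Q\<^esub> inv\<^bsub>Q\<^esub> g \<in> U" using N(2) fg by simp
    then show "U #>\<^bsub>Q\<^esub> f = U #>\<^bsub>Q\<^esub> g" using Q.rcos_eq_iff[OF U(1)] fg by simp
  qed
qed

lemma closed_hull_normal:
  "A \<subseteq> carrier Q \<Longrightarrow> closed_normal_subgroup_generated Q T A \<lhd> Q"
  "A \<subseteq> carrier Q \<Longrightarrow> closedin T (closed_normal_subgroup_generated Q T A)"
proof -
  assume A: "A \<subseteq> carrier Q"
  let ?\<K> = "{K. (K \<lhd> Q \<and> closedin T K) \<and> A \<subseteq> K}"
  have Q: "carrier Q \<in> ?\<K>" using A Q.normal_self closedin_topspace[of T] by simp
  have eq: "closed_normal_subgroup_generated Q T A = \<Inter>?\<K>"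
    by (simp add: closed_normal_subgroup_generated_def hull_def)
  show "closed_normal_subgroup_generated Q T A \<lhd> Q"
  proof (rule Q.normal_invI)
    show "subgroup (closed_normal_subgroup_generated Q T A) Q"
      unfolding eq using Q normal_imp_subgroup by (intro Q.subgroups_Inter) auto
    fix x h assume "x \<in> carrier Q" "h \<in> closed_normal_subgroup_generated Q T A"
    then show "x \<otimes>\<^bsub>Q\<^esub> h \<otimes>\<^bsub>Q\<^esub> inv\<^bsub>Q\<^esub> x \<in> closed_normal_subgroup_generated Q T A"
      unfolding eq using Q.normal_invE(2) by blast
  qed
  show "closedin T (closed_normal_subgroup_generated Q T A)"
    unfolding eq using Q by (intro closedin_Inter) auto
qed

lemma closed_hull_subgroup:
  assumes A: "A \<subseteq> carrier Q"
  shows "subgroup (closed_subgroup_generated Q T A) Q" "closedin T (closed_subgroup_generated Q T A)"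
proof -
  let ?\<K> = "{K. (subgroup K Q \<and> closedin T K) \<and> A \<subseteq> K}"
  have Q: "carrier Q \<in> ?\<K>" using A Q.subgroup_self closedin_topspace[of T] by simp
  have eq: "closed_subgroup_generated Q T A = \<Inter>?\<K>"
    by (simp add: closed_subgroup_generated_def hull_def)
  show "subgroup (closed_subgroup_generated Q T A) Q"
    unfolding eq using Q by (intro Q.subgroups_Inter) auto
  show "closedin T (closed_subgroup_generated Q T A)"
    unfolding eq using Q by (intro closedin_Inter) auto
qed

lemma component_hom:
  assumes N: "N \<in> \<N>"
  shows "group_hom Q (G Mod N) (\<lambda>f. f N)"
  using normal.factorgroup_is_group[OF \<N>D(1)[OF N]] Q_mem_Mod[OF _ N] Q_mult[OF N]
  by (intro group_hom.intro group_Q group_hom_axioms.intro) (auto simp: hom_def)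

lemma component_surj: "N \<in> \<N> \<Longrightarrow> (\<lambda>f. f N) ` carrier Q = carrier (G Mod N)"
proof
  assume N: "N \<in> \<N>"
  show "(\<lambda>f. f N) ` carrier Q \<subseteq> carrier (G Mod N)" using Q_mem_Mod[OF _ N] by blast
  show "carrier (G Mod N) \<subseteq> (\<lambda>f. f N) ` carrier Q"
  proof
    fix c assume "c \<in> carrier (G Mod N)"
    then obtain x where "x \<in> carrier G" "c = N #> x" by (auto simp: carrier_FactGroup)
    then have "c = completion_map p G x N" "completion_map p G x \<in> carrier Q"
      using completion_map_apply[OF N] completion_map_closed by simp_all
    then show "c \<in> (\<lambda>f. f N) ` carrier Q" by blast
  qed
qed

text \<open>The set \<open>V\<close> is the product of \<open>R\<close> and the kernel of the projection to \<open>G/N\<close>.\<close>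

lemma open_normal_thickening:
  assumes R: "R \<lhd> Q" and N: "N \<in> \<N>" and V: "V = {f \<in> carrier Q. f N \<in> (\<lambda>g. g N) ` R}"
  shows "V \<in> open_normal_subgroups Q T" "R \<subseteq> V" "finite (carrier (Q Mod V))"
proof -
  interpret ev: group_hom Q "G Mod N" "\<lambda>f. f N" by (rule component_hom[OF N])
  have "(\<lambda>g. g N) ` R \<lhd> G Mod N"
    using normal.surj_hom_normal_subgroup[OF R ev.group_hom_axioms component_surj[OF N]] .
  then have Vn: "V \<lhd> Q" unfolding V by (rule ev.normal_preimage)
  then show "V \<in> open_normal_subgroups Q T"
    using clopen_component(1)[OF N] by (simp add: open_normal_subgroups_def V)
  show "R \<subseteq> V" using subgroup.subset[OF normal_imp_subgroup[OF R]] by (auto simp: V)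
  have dep: "V #>\<^bsub>Q\<^esub> f = V #>\<^bsub>Q\<^esub> g" if fg: "f \<in> carrier Q" "g \<in> carrier Q" "f N = g N" for f g
  proof -
    have "(f \<otimes>\<^bsub>Q\<^esub> inv\<^bsub>Q\<^esub> g) N = \<one>\<^bsub>Q\<^esub> N" using Q_eq_iff[OF fg(1,2) N] fg(3) Q_one[OF N] by simp
    then have "(f \<otimes>\<^bsub>Q\<^esub> inv\<^bsub>Q\<^esub> g) N \<in> (\<lambda>g. g N) ` R"
      by (rule image_eqI[OF _ subgroup.one_closed[OF normal_imp_subgroup[OF R]]])
    moreover have "f \<otimes>\<^bsub>Q\<^esub> inv\<^bsub>Q\<^esub> g \<in> carrier Q"
      by (rule Q.m_closed[OF fg(1) Q.inv_closed[OF fg(2)]])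
    ultimately have "f \<otimes>\<^bsub>Q\<^esub> inv\<^bsub>Q\<^esub> g \<in> V" unfolding V by (intro CollectI conjI)
    then show ?thesis using Q.rcos_eq_iff[OF normal_imp_subgroup[OF Vn] fg(1,2)] by simp
  qed
  define s where "s c = (SOME f. f \<in> carrier Q \<and> f N = c)" for c
  have s: "s (f N) \<in> carrier Q \<and> s (f N) N = f N" if "f \<in> carrier Q" for f
    unfolding s_def by (rule someI[of _ f]) (use that in simp)
  have "carrier (Q Mod V) \<subseteq> (\<lambda>c. V #>\<^bsub>Q\<^esub> s c) ` carrier (G Mod N)"
  proof
    fix C assume "C \<in> carrier (Q Mod V)"
    then obtain f where f: "f \<in> carrier Q" "C = V #>\<^bsub>Q\<^esub> f" by (auto simp: carrier_FactGroup)
    then have "C = V #>\<^bsub>Q\<^esub> s (f N)" using dep[OF f(1)] s[OF f(1)] by metis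
    then show "C \<in> (\<lambda>c. V #>\<^bsub>Q\<^esub> s c) ` carrier (G Mod N)" using Q_mem_Mod[OF f(1) N] by blast
  qed
  then show "finite (carrier (Q Mod V))" by (rule finite_subset[OF _ finite_imageI[OF \<N>D(4)[OF N]]])
qed

end

section \<open>A character that detects the relator\<close>

context pro_p_setting
begin

text \<open>Take \<open>N\<close> of least \<open>p\<close>-power index among the subgroups at which \<open>x\<close> is not trivial. A central
  subgroup of order \<open>p\<close> of the \<open>p\<close>-group \<open>G/N\<close> corresponds to a larger normal subgroup, at which \<open>x\<close>
  is trivial; so the image of \<open>x\<close> lies in this central subgroup.\<close>

lemma exists_central_component:
  assumes x: "x \<in> carrier Q" and ne: "x \<noteq> \<one>\<^bsub>Q\<^esub>"
  obtains N where "N \<in> \<N>" "x N \<noteq> N" "x N [^]\<^bsub>G Mod N\<^esub> p = N"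
    "\<And>C. C \<in> carrier (G Mod N) \<Longrightarrow> C <#> x N = x N <#> C"
proof -
  let ?P = "\<lambda>N. N \<in> \<N> \<and> x N \<noteq> N"
  have "\<exists>N. ?P N"
    using Q_eqI[OF x Q.one_closed] ne Q_one by auto
  then obtain N where N: "?P N" and least: "\<And>M. ?P M \<Longrightarrow> order (G Mod N) \<le> order (G Mod M)"
    using ex_has_least_nat[of ?P _ "\<lambda>N. order (G Mod N)"] by blast
  then have N\<N>: "N \<in> \<N>" by simp
  interpret N: normal N G by (rule \<N>D(1)[OF N\<N>])
  interpret F: group "G Mod N" by (rule N.factorgroup_is_group)
  interpret h: group_hom G "G Mod N" "(#>) N"
    by (intro group_hom.intro is_group F.is_group group_hom_axioms.intro N.r_coset_hom_Mod)
  obtain k where k: "order (G Mod N) = p ^ k" using N\<N> by (auto simp: p_power_index_normal_def)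
  obtain w where w: "w \<in> carrier G" "x N = N #> w" using Q_coset[OF x N\<N>] .
  have "x N \<in> carrier (G Mod N)" "N \<in> carrier (G Mod N)"
    using Q_mem_Mod[OF x N\<N>] F.one_closed by auto
  then have "card {N, x N} \<le> order (G Mod N)"
    unfolding order_def using \<N>D(4)[OF N\<N>] by (intro card_mono) auto
  moreover have "card {N, x N} = 2" using N by (metis card_2_iff)
  ultimately have gt: "order (G Mod N) > 1" by simp
  obtain z where z: "z \<in> carrier (G Mod N)" "z \<noteq> N" "z [^]\<^bsub>G Mod N\<^esub> p = N"
    "\<And>C. C \<in> carrier (G Mod N) \<Longrightarrow> C \<otimes>\<^bsub>G Mod N\<^esub> z = z \<otimes>\<^bsub>G Mod N\<^esub> C"
    using F.p_group_central_order_p[OF prime_p k gt] unfolding one_FactGroup by blast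
  let ?Z = "range (\<lambda>i::int. z [^]\<^bsub>G Mod N\<^esub> i)"
  have Zn: "?Z \<lhd> G Mod N" by (rule F.normal_central_powers[OF z(1,4)])
  \<comment> \<open>This subgroup is strictly larger than \<open>N\<close>, so \<open>x\<close> is trivial at \<open>M\<close> by the choice of \<open>N\<close>.\<close>
  define M where "M = {g \<in> carrier G. N #> g \<in> ?Z}"
  have M: "M \<lhd> G" unfolding M_def by (rule h.normal_preimage[OF Zn])
  have NM: "N \<subseteq> M"
  proof
    fix g assume g: "g \<in> N"
    then have "N #> g = z [^]\<^bsub>G Mod N\<^esub> (0::int)" using rcos_eq_self_iff[OF N.subgroup_axioms] by simp
    then have "N #> g \<in> ?Z" by (rule range_eqI)
    then show "g \<in> M" using g N.subset unfolding M_def by blast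
  qed
  obtain c where c: "c \<in> carrier G" "z = N #> c" using z(1) by (auto simp: carrier_FactGroup)
  have "N #> c = z [^]\<^bsub>G Mod N\<^esub> (1::int)" using c z(1) F.int_pow_1 by simp
  then have "c \<in> M" using c(1) unfolding M_def by simp
  moreover have "c \<notin> N" using z(2) c rcos_eq_self_iff[OF N.subgroup_axioms] by simp
  ultimately have "N \<noteq> M" by blast
  then have "M \<in> \<N>" "order (G Mod M) < order (G Mod N)" using \<N>_supgroup[OF N\<N> M NM] by auto
  then have "x M = M" using least[of M] by fastforce
  moreover have "x M = M #> w" using Q_coherent_rcos[OF x N\<N> \<open>M \<in> \<N>\<close> NM w] .
  ultimately have "w \<in> M" using rcos_eq_self_iff[OF normal_imp_subgroup[OF M] w(1)] by simp
  then have xZ: "x N \<in> ?Z" using w(2) by (simp add: M_def)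
  then obtain i :: int where i: "x N = z [^]\<^bsub>G Mod N\<^esub> i" by blast
  have "x N [^]\<^bsub>G Mod N\<^esub> p = N"
    using F.int_pow_pow_eq_one[OF z(1), of p i] z(3) i by simp
  moreover have "C <#> x N = x N <#> C" if "C \<in> carrier (G Mod N)" for C
    using F.central_int_pow[OF z(1,4) that, of i] i by simp
  ultimately show thesis using that[OF N\<N>] N by blast
qed

text \<open>Choose \<open>N1\<close> such that \<open>r\<close> is central of order \<open>p\<close> in \<open>G/N1\<close>. Then \<open>R\<close>, being generated by \<open>r\<close> as
  a closed normal subgroup, maps to the powers of \<open>r\<close>, and \<open>\<phi>\<close> is the exponent modulo \<open>p\<close>. The subgroup
  \<open>N \<subseteq> N1\<close> is so small that an element of \<open>H\<close> which agrees with an element of \<open>R\<close> at \<open>N\<close> is trivial in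
  \<open>G/N1\<close>; its conjugates are then trivial there as well, so \<open>\<phi>\<close> vanishes on them.\<close>

lemma exists_character:
  assumes r: "r \<in> carrier Q" "r \<noteq> \<one>\<^bsub>Q\<^esub>" and R: "R = closed_normal_subgroup_generated Q T {r}"
    and H: "closedin T H" and HR: "H \<inter> R = {\<one>\<^bsub>Q\<^esub>}"
  obtains N and \<phi> :: "'a \<Rightarrow> int" where "N \<in> \<N>"
    and "\<And>x y. x \<in> carrier G \<Longrightarrow> y \<in> carrier G \<Longrightarrow> N #> x \<in> (\<lambda>g. g N) ` R \<Longrightarrow> N #> y \<in> (\<lambda>g. g N) ` R \<Longrightarrow>
          [\<phi> (x \<otimes> y) = \<phi> x + \<phi> y] (mod int p)"
    and "\<And>a g. a \<in> carrier G \<Longrightarrow> completion_map p G a \<in> H \<Longrightarrow> g \<in> carrier G \<Longrightarrow>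
          N #> (inv g \<otimes> a \<otimes> g) \<in> (\<lambda>g. g N) ` R \<Longrightarrow> [\<phi> (inv g \<otimes> a \<otimes> g) = 0] (mod int p)"
    and "\<And>w. w \<in> carrier G \<Longrightarrow> N #> w = r N \<Longrightarrow> [\<phi> w = 1] (mod int p)"
proof -
  have rQ: "{r} \<subseteq> carrier Q" using r by simp
  have Rn: "R \<lhd> Q" and Rc: "closedin T R" unfolding R using closed_hull_normal[OF rQ] by auto
  have RQ: "R \<subseteq> carrier Q" using subgroup.subset[OF normal_imp_subgroup[OF Rn]] .
  obtain N1 where N1: "N1 \<in> \<N>" "r N1 \<noteq> N1" "r N1 [^]\<^bsub>G Mod N1\<^esub> p = N1"
    "\<And>C. C \<in> carrier (G Mod N1) \<Longrightarrow> C <#> r N1 = r N1 <#> C"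
    using exists_central_component[OF r] by blast
  interpret N1: normal N1 G by (rule \<N>D(1)[OF N1(1)])
  interpret F1: group "G Mod N1" by (rule N1.factorgroup_is_group)
  interpret ev: group_hom Q "G Mod N1" "\<lambda>f. f N1" by (rule component_hom[OF N1(1)])
  define \<rho> where "\<rho> = r N1"
  have \<rho>: "\<rho> \<in> carrier (G Mod N1)" using Q_mem_Mod[OF r(1) N1(1)] by (simp add: \<rho>_def)
  let ?pow = "\<lambda>i::int. \<rho> [^]\<^bsub>G Mod N1\<^esub> i"
  have "range ?pow \<lhd> G Mod N1"
    using N1(4) by (intro F1.normal_central_powers \<rho>) (simp add: \<rho>_def)
  then have "{f \<in> carrier Q. f N1 \<in> range ?pow} \<lhd> Q" by (rule ev.normal_preimage)
  moreover have "closedin T {f \<in> carrier Q. f N1 \<in> range ?pow}" by (rule clopen_component(2)[OF N1(1)])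
  moreover have "r N1 = ?pow 1" using \<rho> F1.int_pow_1 by (simp add: \<rho>_def)
  then have "{r} \<subseteq> {f \<in> carrier Q. f N1 \<in> range ?pow}" using r(1) by blast
  ultimately have "R \<subseteq> {f \<in> carrier Q. f N1 \<in> range ?pow}"
    unfolding R by (rule hull_subset_closed_normal(2))
  then have Rpow: "\<exists>i. g N1 = ?pow i" if "g \<in> R" for g using that by blast
  have "F1.ord \<rho> dvd p" using F1.pow_eq_id[OF \<rho>] N1(3) by (simp add: \<rho>_def)
  moreover have "F1.ord \<rho> \<noteq> 1" using F1.ord_eq_1[OF \<rho>] N1(2) by (simp add: \<rho>_def)
  ultimately have ord: "F1.ord \<rho> = p" using prime_p by (auto simp: prime_nat_iff)
  have pow_eq: "[i = j] (mod int p)" if "?pow i = ?pow j" for i j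
    using F1.int_pow_eq[OF \<rho>] ord that by (metis cong_iff_dvd_diff cong_sym)
  obtain N' where N': "N' \<in> \<N>" "\<And>h g. h \<in> H \<Longrightarrow> g \<in> R \<Longrightarrow> h N' = g N' \<Longrightarrow> h N1 = N1"
    using separate_closed_sets[OF H Rc _ N1(1)] HR by blast
  define N where "N = N' \<inter> N1"
  have N: "N \<in> \<N>" unfolding N_def by (rule \<N>_Int[OF N'(1) N1(1)])
  have NN1: "N \<subseteq> N1" and NN': "N \<subseteq> N'" by (auto simp: N_def)
  define \<phi> where "\<phi> u = (SOME i::int. N1 #> u = ?pow i)" for u
  have down: "N1 #> u = g N1" if "u \<in> carrier G" "g \<in> carrier Q" "N #> u = g N" for u g
    using Q_coherent_rcos[OF that(2) N N1(1) NN1 that(1)] that(3) by simp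
  have \<phi>: "N1 #> u = ?pow (\<phi> u)" if u: "u \<in> carrier G" "N #> u \<in> (\<lambda>g. g N) ` R" for u
  proof -
    obtain g where g: "g \<in> R" "N #> u = g N" using u(2) by blast
    have "N1 #> u = g N1" using down[of u g] u(1) g RQ by blast
    then have "\<exists>i. N1 #> u = ?pow i" using Rpow[OF g(1)] by simp
    then show ?thesis unfolding \<phi>_def by (rule someI_ex)
  qed
  interpret N: normal N G by (rule \<N>D(1)[OF N])
  interpret evN: group_hom Q "G Mod N" "\<lambda>f. f N" by (rule component_hom[OF N])
  have RN: "(\<lambda>g. g N) ` R \<lhd> G Mod N"
    using normal.surj_hom_normal_subgroup[OF Rn evN.group_hom_axioms component_surj[OF N]] .
  have mult: "N #> (x \<otimes> y) \<in> (\<lambda>g. g N) ` R"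
    if "x \<in> carrier G" "y \<in> carrier G" "N #> x \<in> (\<lambda>g. g N) ` R" "N #> y \<in> (\<lambda>g. g N) ` R" for x y
    using subgroup.m_closed[OF normal_imp_subgroup[OF RN] that(3,4)] N.rcos_sum that(1,2) by simp
  show thesis
  proof (rule that[OF N, of \<phi>])
    fix x y assume xy: "x \<in> carrier G" "y \<in> carrier G" "N #> x \<in> (\<lambda>g. g N) ` R" "N #> y \<in> (\<lambda>g. g N) ` R"
    have "?pow (\<phi> (x \<otimes> y)) = N1 #> (x \<otimes> y)" using \<phi>[OF _ mult[OF xy]] xy by simp
    also have "\<dots> = (N1 #> x) \<otimes>\<^bsub>G Mod N1\<^esub> (N1 #> y)" using N1.rcos_sum xy by simp
    also have "\<dots> = ?pow (\<phi> x) \<otimes>\<^bsub>G Mod N1\<^esub> ?pow (\<phi> y)" by (simp only: \<phi>[OF xy(1,3)] \<phi>[OF xy(2,4)])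
    also have "\<dots> = ?pow (\<phi> x + \<phi> y)" by (rule F1.int_pow_mult[OF \<rho>, symmetric])
    finally show "[\<phi> (x \<otimes> y) = \<phi> x + \<phi> y] (mod int p)" by (rule pow_eq)
  next
    fix a g assume a: "a \<in> carrier G" "completion_map p G a \<in> H" and g: "g \<in> carrier G"
      and c: "N #> (inv g \<otimes> a \<otimes> g) \<in> (\<lambda>g. g N) ` R"
    interpret nat: group_hom G "G Mod N" "(#>) N"
      by (intro group_hom.intro is_group N.factorgroup_is_group group_hom_axioms.intro N.r_coset_hom_Mod)
    let ?K = "{u \<in> carrier G. N #> u \<in> (\<lambda>g. g N) ` R}"
    have K: "?K \<lhd> G" by (rule nat.normal_preimage[OF RN])
    have "g \<otimes> (inv g \<otimes> a \<otimes> g) \<otimes> inv g \<in> ?K"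
      using normal.inv_op_closed2[OF K g, of "inv g \<otimes> a \<otimes> g"] c a(1) g by simp
    moreover have "g \<otimes> (inv g \<otimes> a \<otimes> g) \<otimes> inv g = a"
      using a(1) g by (simp add: m_assoc) (simp add: m_assoc[symmetric])
    ultimately obtain f where f: "f \<in> R" "N #> a = f N" by auto
    have "N' #> a = f N'"
      using Q_coherent_rcos[OF _ N N'(1) NN' a(1)] f RQ by (metis subsetD)
    then have "completion_map p G a N1 = N1"
      using N'(2)[OF a(2) f(1)] completion_map_apply[OF N'(1)] by simp
    then have "a \<in> N1"
      using completion_map_apply[OF N1(1)] rcos_eq_self_iff[OF N1.subgroup_axioms a(1)] by simp
    then have "inv g \<otimes> a \<otimes> g \<in> N1" by (rule N1.inv_op_closed1[OF g])
    then have "N1 #> (inv g \<otimes> a \<otimes> g) = ?pow 0"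
      using rcos_eq_self_iff[OF N1.subgroup_axioms] a(1) g by simp
    then have "?pow (\<phi> (inv g \<otimes> a \<otimes> g)) = ?pow 0" using \<phi>[OF _ c] a(1) g by simp
    then show "[\<phi> (inv g \<otimes> a \<otimes> g) = 0] (mod int p)" by (rule pow_eq)
  next
    fix w assume w: "w \<in> carrier G" "N #> w = r N"
    have "r \<in> R" using hull_subset_closed_normal(1)[of "{r}"] R by blast
    then have "?pow (\<phi> w) = N1 #> w" using \<phi>[OF w(1)] w(2) by blast
    also have "\<dots> = ?pow 1" using down[of w r] w r(1) \<rho> F1.int_pow_1 by (simp add: \<rho>_def)
    finally show "[\<phi> w = 1] (mod int p)" by (rule pow_eq)
  qed
qed

end

section \<open>Fox calculus in discrete free groups\<close>

text \<open>On each double coset fix a representative \<open>s\<close> and put \<open>\<tau>(a s k) = \<phi>(k)\<close>. If \<open>a s k = b s l\<close>, then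
  \<open>l k\<^sup>-\<^sup>1 = s\<^sup>-\<^sup>1 (b\<^sup>-\<^sup>1 a) s\<close> lies in \<open>K\<close> and in a conjugate of \<open>A\<close>, where \<open>\<phi>\<close> vanishes; hence \<open>\<tau>\<close> is
  well defined modulo \<open>p\<close>.\<close>

lemma (in group) double_coset_extension:
  fixes \<phi> :: "'a \<Rightarrow> int" and p :: int
  assumes A: "subgroup A G" and K: "subgroup K G"
    and hom: "\<And>x y. x \<in> K \<Longrightarrow> y \<in> K \<Longrightarrow> [\<phi> (x \<otimes> y) = \<phi> x + \<phi> y] (mod p)"
    and conj: "\<And>a g. a \<in> A \<Longrightarrow> g \<in> carrier G \<Longrightarrow> inv g \<otimes> a \<otimes> g \<in> K \<Longrightarrow> [\<phi> (inv g \<otimes> a \<otimes> g) = 0] (mod p)"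
  obtains \<tau> :: "'a \<Rightarrow> int"
  where "\<And>g k. g \<in> carrier G \<Longrightarrow> k \<in> K \<Longrightarrow> [\<tau> (g \<otimes> k) = \<tau> g + \<phi> k] (mod p)"
    and "\<And>a g. a \<in> A \<Longrightarrow> g \<in> carrier G \<Longrightarrow> [\<tau> (a \<otimes> g) = \<tau> g] (mod p)"
proof -
  interpret A: subgroup A G by (rule A)
  interpret K: subgroup K G by (rule K)
  have cancel: "inv x \<otimes> (x \<otimes> y) = y" "x \<otimes> (inv x \<otimes> y) = y"
    if "x \<in> carrier G" "y \<in> carrier G" for x y
    using that by (simp_all add: m_assoc[symmetric])
  \<comment> \<open>The representative \<open>\<rho> g\<close> depends only on the double coset \<open>D g\<close>, and \<open>\<kappa> g\<close> is the
    right factor of one chosen decomposition.\<close>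
  define D where "D g = {a \<otimes> g \<otimes> k | a k. a \<in> A \<and> k \<in> K}" for g
  have D_self: "g \<in> D g" if g: "g \<in> carrier G" for g
  proof -
    have "g = \<one> \<otimes> g \<otimes> \<one>" using g by simp
    then show ?thesis unfolding D_def using A.one_closed K.one_closed by blast
  qed
  have D_carrier: "D g \<subseteq> carrier G" if "g \<in> carrier G" for g
    using that by (auto simp: D_def)
  have D_mono: "D (a \<otimes> g \<otimes> k) \<subseteq> D g" if a: "a \<in> A" and k: "k \<in> K" and g: "g \<in> carrier G" for a g k
  proof
    fix x assume "x \<in> D (a \<otimes> g \<otimes> k)"
    then obtain b l where bl: "b \<in> A" "l \<in> K" "x = b \<otimes> (a \<otimes> g \<otimes> k) \<otimes> l" by (auto simp: D_def)
    then have "x = (b \<otimes> a) \<otimes> g \<otimes> (k \<otimes> l)" using a k g by (simp add: m_assoc)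
    then show "x \<in> D g" using bl a k A.m_closed K.m_closed unfolding D_def by blast
  qed
  have D_eq: "D (a \<otimes> g \<otimes> k) = D g" if a: "a \<in> A" and k: "k \<in> K" and g: "g \<in> carrier G" for a g k
  proof
    let ?x = "a \<otimes> g \<otimes> k"
    have "inv a \<otimes> ?x \<otimes> inv k = g" using a k g by (simp add: m_assoc cancel)
    then show "D g \<subseteq> D ?x"
      using D_mono[of "inv a" "inv k" ?x] a k g by simp
  qed (rule D_mono[OF that])
  define \<rho> where "\<rho> g = (SOME x. x \<in> D g)" for g
  have \<rho>D: "\<rho> g \<in> D g" if "g \<in> carrier G" for g
    unfolding \<rho>_def using D_self[OF that] by (rule someI)
  then have \<rho>: "\<rho> g \<in> carrier G" if "g \<in> carrier G" for g using D_carrier that by blast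
  have \<rho>_eq: "\<rho> (a \<otimes> g \<otimes> k) = \<rho> g" if "a \<in> A" "k \<in> K" "g \<in> carrier G" for a g k
    using D_eq[OF that] by (simp add: \<rho>_def)
  define \<kappa> where "\<kappa> g = (SOME k. k \<in> K \<and> (\<exists>a\<in>A. g = a \<otimes> \<rho> g \<otimes> k))" for g
  have \<kappa>: "\<kappa> g \<in> K \<and> (\<exists>a\<in>A. g = a \<otimes> \<rho> g \<otimes> \<kappa> g)" if g: "g \<in> carrier G" for g
    unfolding \<kappa>_def
  proof (rule someI_ex)
    obtain a k where ak: "a \<in> A" "k \<in> K" "\<rho> g = a \<otimes> g \<otimes> k" using \<rho>D[OF g] by (auto simp: D_def)
    then have "g = inv a \<otimes> \<rho> g \<otimes> inv k" using g by (simp add: m_assoc cancel)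
    then show "\<exists>k. k \<in> K \<and> (\<exists>a\<in>A. g = a \<otimes> \<rho> g \<otimes> k)"
      using ak A.m_inv_closed K.m_inv_closed by blast
  qed
  have val: "[\<phi> (\<kappa> g) = \<phi> k] (mod p)"
    if g: "g \<in> carrier G" and a: "a \<in> A" and k: "k \<in> K" and eq: "g = a \<otimes> \<rho> g \<otimes> k" for g a k
  proof -
    define s where "s = \<rho> g"
    have s: "s \<in> carrier G" using \<rho>[OF g] by (simp add: s_def)
    obtain b where b: "b \<in> A" "g = b \<otimes> s \<otimes> \<kappa> g" using \<kappa>[OF g] by (auto simp: s_def)
    have l: "\<kappa> g \<in> K" using \<kappa>[OF g] by simp
    have "b \<otimes> s \<otimes> \<kappa> g = a \<otimes> s \<otimes> k" using b(2) eq by (simp add: s_def)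
    then have "inv b \<otimes> (b \<otimes> s \<otimes> \<kappa> g) = inv b \<otimes> (a \<otimes> s \<otimes> k)" by simp
    then have sl: "s \<otimes> \<kappa> g = inv b \<otimes> (a \<otimes> s \<otimes> k)"
      using b(1) s l by (simp add: m_assoc cancel)
    then have "inv s \<otimes> (s \<otimes> \<kappa> g) = inv s \<otimes> (inv b \<otimes> (a \<otimes> s \<otimes> k))" by simp
    then have e: "\<kappa> g = (inv s \<otimes> (inv b \<otimes> a) \<otimes> s) \<otimes> k"
      using b(1) a s k l by (simp add: m_assoc cancel)
    have "\<kappa> g \<otimes> inv k = inv s \<otimes> (inv b \<otimes> a) \<otimes> s"
      by (subst e) (use b(1) a s k in \<open>simp add: m_assoc\<close>)
    then have cK: "inv s \<otimes> (inv b \<otimes> a) \<otimes> s \<in> K"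
      using K.m_closed[OF l K.m_inv_closed[OF k]] by simp
    have "[\<phi> (\<kappa> g) = \<phi> (inv s \<otimes> (inv b \<otimes> a) \<otimes> s) + \<phi> k] (mod p)"
      using hom[OF cK k] e by simp
    moreover have "[\<phi> (inv s \<otimes> (inv b \<otimes> a) \<otimes> s) = 0] (mod p)"
      using conj[OF _ s cK] b(1) a by simp
    ultimately show ?thesis
      by (metis add.left_neutral cong_add_rcancel cong_trans)
  qed
  show thesis
  proof (rule that[of "\<lambda>g. \<phi> (\<kappa> g)"])
    fix g k assume g: "g \<in> carrier G" and k: "k \<in> K"
    obtain a where a: "a \<in> A" "g = a \<otimes> \<rho> g \<otimes> \<kappa> g" using \<kappa>[OF g] by auto
    have l: "\<kappa> g \<in> K" using \<kappa>[OF g] by simp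
    have "\<rho> (g \<otimes> k) = \<rho> g" using \<rho>_eq[of \<one> k g] g k by simp
    moreover have "g \<otimes> k = a \<otimes> \<rho> g \<otimes> (\<kappa> g \<otimes> k)"
      using a(1) l k \<rho>[OF g] by (subst a(2)) (simp add: m_assoc)
    ultimately have "g \<otimes> k = a \<otimes> \<rho> (g \<otimes> k) \<otimes> (\<kappa> g \<otimes> k)" by simp
    then have "[\<phi> (\<kappa> (g \<otimes> k)) = \<phi> (\<kappa> g \<otimes> k)] (mod p)"
      using g k a(1) l by (intro val) simp_all
    then show "[\<phi> (\<kappa> (g \<otimes> k)) = \<phi> (\<kappa> g) + \<phi> k] (mod p)"
      using hom[OF l k] by (rule cong_trans)
  next
    fix b g assume b: "b \<in> A" and g: "g \<in> carrier G"
    obtain a where a: "a \<in> A" "g = a \<otimes> \<rho> g \<otimes> \<kappa> g" using \<kappa>[OF g] by auto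
    have l: "\<kappa> g \<in> K" using \<kappa>[OF g] by simp
    have "\<rho> (b \<otimes> g) = \<rho> g" using \<rho>_eq[of b \<one> g] g b by simp
    moreover have "b \<otimes> g = (b \<otimes> a) \<otimes> \<rho> g \<otimes> \<kappa> g"
      using a(1) l b \<rho>[OF g] by (subst a(2)) (simp add: m_assoc)
    ultimately have "b \<otimes> g = (b \<otimes> a) \<otimes> \<rho> (b \<otimes> g) \<otimes> \<kappa> g" by simp
    then show "[\<phi> (\<kappa> (b \<otimes> g)) = \<phi> (\<kappa> g)] (mod p)"
      using g b a(1) l by (intro val) simp_all
  qed
qed

definition ring_pairing :: "('g, 'k) monoid_scheme \<Rightarrow> ('g \<Rightarrow> int) \<Rightarrow> ('g \<Rightarrow> int) \<Rightarrow> int" where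
  "ring_pairing G a f = (\<Sum>g\<in>{g \<in> carrier G. a g \<noteq> 0}. a g * f g)"

context group
begin

lemma group_ring_of_apply: "g \<in> carrier G \<Longrightarrow> group_ring_of R G v g = (if g = v then \<one>\<^bsub>R\<^esub> else \<zero>\<^bsub>R\<^esub>)"
  by (simp add: group_ring_of_def)

lemma group_ring_of_closed:
  assumes "\<one>\<^bsub>R\<^esub> \<in> carrier R" "\<zero>\<^bsub>R\<^esub> \<in> carrier R"
  shows "group_ring_of R G v \<in> carrier (group_ring R G)"
proof -
  have "{g \<in> carrier G. group_ring_of R G v g \<noteq> \<zero>\<^bsub>R\<^esub>} \<subseteq> {v}"
    by (auto simp: group_ring_of_apply split: if_splits)
  then show ?thesis using assms finite_subset by (fastforce simp: group_ring_def group_ring_of_def)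
qed

lemma int_group_ring_finite_support:
  "a \<in> carrier (group_ring \<Z> G) \<Longrightarrow> finite {g \<in> carrier G. a g \<noteq> 0}"
  by (simp add: group_ring_def)

lemma int_group_ring_add: "g \<in> carrier G \<Longrightarrow> (a \<oplus>\<^bsub>group_ring \<Z> G\<^esub> b) g = a g + b g"
  by (simp add: group_ring_def)

lemma int_group_ring_mult_of:
  assumes a: "a \<in> carrier (group_ring \<Z> G)" and v: "v \<in> carrier G" and g: "g \<in> carrier G"
  shows "(a \<otimes>\<^bsub>group_ring \<Z> G\<^esub> group_ring_of \<Z> G v) g = a (g \<otimes> inv v)"
proof -
  let ?S = "{h \<in> carrier G. a h \<noteq> 0}"
  have iff: "inv h \<otimes> g = v \<longleftrightarrow> h = g \<otimes> inv v" if "h \<in> carrier G" for h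
    using that g v by (metis inv_solve_left inv_solve_right)
  have "(a \<otimes>\<^bsub>group_ring \<Z> G\<^esub> group_ring_of \<Z> G v) g
      = (\<Sum>h\<in>?S. a h * group_ring_of \<Z> G v (inv h \<otimes> g))"
    using g by (simp add: group_ring_def int_finsum_eq)
  also have "\<dots> = (\<Sum>h\<in>?S. if h = g \<otimes> inv v then a h else 0)"
    using g iff by (intro sum.cong) (auto simp: group_ring_of_apply)
  also have "\<dots> = a (g \<otimes> inv v)"
    using int_group_ring_finite_support[OF a] g v by simp
  finally show ?thesis .
qed

lemma int_group_ring_of_mult:
  assumes "v \<in> carrier G" "w \<in> carrier G"
  shows "group_ring_of \<Z> G v \<otimes>\<^bsub>group_ring \<Z> G\<^esub> group_ring_of \<Z> G w = group_ring_of \<Z> G (v \<otimes> w)"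
proof
  fix g
  show "(group_ring_of \<Z> G v \<otimes>\<^bsub>group_ring \<Z> G\<^esub> group_ring_of \<Z> G w) g = group_ring_of \<Z> G (v \<otimes> w) g"
  proof (cases "g \<in> carrier G")
    case True
    have "g \<otimes> inv w = v \<longleftrightarrow> g = v \<otimes> w" using True assms by (metis inv_solve_right')
    then show ?thesis
      using int_group_ring_mult_of[OF group_ring_of_closed assms(2) True] True assms
      by (simp add: group_ring_of_apply)
  next
    case False
    then show ?thesis by (simp add: group_ring_def group_ring_of_def)
  qed
qed

lemma augmentation_of: "v \<in> carrier G \<Longrightarrow> augmentation \<Z> G (group_ring_of \<Z> G v) = 1"
proof -
  assume v: "v \<in> carrier G"
  have "{x \<in> carrier G. group_ring_of \<Z> G v x \<noteq> 0} = {v}"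
    using v by (auto simp: group_ring_of_apply split: if_splits)
  then show ?thesis
    using v by (simp add: augmentation_def int_finsum_eq group_ring_of_apply)
qed

lemma ring_pairing_superset:
  assumes "finite B" "{g \<in> carrier G. a g \<noteq> 0} \<subseteq> B" "B \<subseteq> carrier G"
  shows "ring_pairing G a f = (\<Sum>g\<in>B. a g * f g)"
  unfolding ring_pairing_def using assms by (intro sum.mono_neutral_left) auto

lemma ring_pairing_add:
  assumes "finite {g \<in> carrier G. a g \<noteq> 0}" "finite {g \<in> carrier G. b g \<noteq> 0}"
    and c: "\<And>g. g \<in> carrier G \<Longrightarrow> c g = a g + b g"
  shows "ring_pairing G c f = ring_pairing G a f + ring_pairing G b f"
proof -
  let ?B = "{g \<in> carrier G. a g \<noteq> 0} \<union> {g \<in> carrier G. b g \<noteq> 0}"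
  have B: "finite ?B" "?B \<subseteq> carrier G" using assms(1,2) by auto
  have "{g \<in> carrier G. c g \<noteq> 0} \<subseteq> ?B" using c by auto
  then have "ring_pairing G c f = (\<Sum>g\<in>?B. c g * f g)" using B by (intro ring_pairing_superset) auto
  also have "\<dots> = (\<Sum>g\<in>?B. a g * f g) + (\<Sum>g\<in>?B. b g * f g)"
    unfolding sum.distrib[symmetric] using c by (intro sum.cong) (auto simp: distrib_right)
  also have "\<dots> = ring_pairing G a f + ring_pairing G b f"
    using B by (simp add: ring_pairing_superset[of ?B])
  finally show ?thesis .
qed

lemma ring_pairing_of: "v \<in> carrier G \<Longrightarrow> ring_pairing G (group_ring_of \<Z> G v) f = f v"
  by (subst ring_pairing_superset[of "{v}"]) (auto simp: group_ring_of_apply split: if_splits)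

text \<open>Group the sum by the fibres of \<open>q\<close>; on each of them \<open>f\<close> is constant modulo \<open>p\<close> and can be
  factored out.\<close>

lemma ring_pairing_cong_0:
  fixes p :: int
  assumes a: "finite {g \<in> carrier G. a g \<noteq> 0}"
    and zero: "\<And>c. p dvd (\<Sum>g\<in>{g \<in> carrier G. a g \<noteq> 0 \<and> q g = c}. a g)"
    and f: "\<And>g h. g \<in> carrier G \<Longrightarrow> h \<in> carrier G \<Longrightarrow> q g = q h \<Longrightarrow> [f g = f h] (mod p)"
  shows "[ring_pairing G a f = 0] (mod p)"
proof -
  let ?S = "{g \<in> carrier G. a g \<noteq> 0}"
  have fib: "[(\<Sum>g\<in>{g \<in> ?S. q g = c}. a g * f g) = 0] (mod p)" if c: "c \<in> q ` ?S" for c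
  proof -
    obtain h where h: "h \<in> ?S" "q h = c" using c by blast
    have "[(\<Sum>g\<in>{g \<in> ?S. q g = c}. a g * f g) = (\<Sum>g\<in>{g \<in> ?S. q g = c}. a g * f h)] (mod p)"
      using f h by (intro cong_sum cong_mult) auto
    also have "(\<Sum>g\<in>{g \<in> ?S. q g = c}. a g * f h) = (\<Sum>g\<in>{g \<in> carrier G. a g \<noteq> 0 \<and> q g = c}. a g) * f h"
      by (simp add: sum_distrib_right conj_assoc)
    also have "[\<dots> = 0] (mod p)" using zero[of c] unfolding cong_0_iff by (rule dvd_mult2)
    finally show ?thesis .
  qed
  have "ring_pairing G a f = (\<Sum>c\<in>q ` ?S. \<Sum>g\<in>{g \<in> ?S. q g = c}. a g * f g)"
    unfolding ring_pairing_def by (rule sum.image_gen[OF a])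
  also have "[\<dots> = (\<Sum>c\<in>q ` ?S. 0)] (mod p)" by (rule cong_sum) (rule fib)
  finally show ?thesis by simp
qed

end

lemma add_pow_one_int_group_ring:
  assumes "x \<in> carrier (group_ring \<Z> G)"
  shows "[(1::int)] \<cdot>\<^bsub>group_ring \<Z> G\<^esub> x = x"
proof -
  have "x \<in> extensional (carrier G)" using assms by (auto simp: group_ring_def PiE_def)
  then show ?thesis
    by (auto simp: add_pow_def int_pow_def nat_pow_def group_ring_def fun_eq_iff extensional_def)
qed

text \<open>The general formula is
  \<open>\<tau>(w) - \<tau>(1) = \<Sum>\<^sub>j \<Sum>\<^sub>u (D\<^sub>j w)(u) (\<tau>(x\<^sub>j u) - \<tau>(u))\<close>, and the invariance of \<open>\<tau>\<close> leaves only the summand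
  \<open>j = k\<close>. An inverse letter is handled by applying the product rule to \<open>u = x\<^sub>j (x\<^sub>j\<^sup>-\<^sup>1 u)\<close>.\<close>

lemma fox_fundamental_formula:
  fixes p :: int and \<tau> :: "word \<Rightarrow> int"
  assumes D: "is_discrete_fox_derivative n k D" and k: "k \<in> {1..n}"
    and \<tau>: "\<And>j u. j \<in> {1..n} - {k} \<Longrightarrow> u \<in> carrier (free_group n) \<Longrightarrow>
            [\<tau> (free_gen j \<otimes>\<^bsub>free_group n\<^esub> u) = \<tau> u] (mod p)"
    and w: "w \<in> carrier (free_group n)"
  shows "[\<tau> w - \<tau> \<one>\<^bsub>free_group n\<^esub> = ring_pairing (free_group n)
            (D (group_ring_of \<Z> (free_group n) w))
            (\<lambda>u. \<tau> (free_gen k \<otimes>\<^bsub>free_group n\<^esub> u) - \<tau> u)] (mod p)"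
proof -
  let ?F = "free_group n"
  let ?ZF = "group_ring \<Z> ?F"
  let ?of = "group_ring_of \<Z> ?F"
  let ?f = "\<lambda>u. \<tau> (free_gen k \<otimes>\<^bsub>?F\<^esub> u) - \<tau> u"
  interpret F: group ?F by (rule group_free_group)
  have of: "?of v \<in> carrier ?ZF" for v by (rule F.group_ring_of_closed) simp_all
  have DZ: "D a \<in> carrier ?ZF" if "a \<in> carrier ?ZF" for a
    using D that unfolding is_discrete_fox_derivative_def by blast
  have fin: "finite {g \<in> carrier ?F. D (?of v) g \<noteq> 0}" for v
    using F.int_group_ring_finite_support[OF DZ[OF of]] .
  have prod: "D (?of (v \<otimes>\<^bsub>?F\<^esub> u)) g = D (?of v) (g \<otimes>\<^bsub>?F\<^esub> inv\<^bsub>?F\<^esub> u) + D (?of u) g"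
    if v: "v \<in> carrier ?F" and u: "u \<in> carrier ?F" and g: "g \<in> carrier ?F" for v u g
  proof -
    have "D (?of v \<otimes>\<^bsub>?ZF\<^esub> ?of u) = D (?of v) \<otimes>\<^bsub>?ZF\<^esub> ?of u \<oplus>\<^bsub>?ZF\<^esub> [augmentation \<Z> ?F (?of v)] \<cdot>\<^bsub>?ZF\<^esub> D (?of u)"
      using D of unfolding is_discrete_fox_derivative_def by blast
    then have "D (?of (v \<otimes>\<^bsub>?F\<^esub> u)) = D (?of v) \<otimes>\<^bsub>?ZF\<^esub> ?of u \<oplus>\<^bsub>?ZF\<^esub> D (?of u)"
      by (simp only: F.int_group_ring_of_mult[OF v u] F.augmentation_of[OF v]
          add_pow_one_int_group_ring[OF DZ[OF of]])
    then show ?thesis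
      using F.int_group_ring_add[OF g] F.int_group_ring_mult_of[OF DZ[OF of] u g] by simp
  qed
  have gen: "D (?of (free_gen j)) g = (if j = k \<and> g = \<one>\<^bsub>?F\<^esub> then 1 else 0)"
    if "j \<in> {1..n}" "g \<in> carrier ?F" for j g
  proof -
    have "D (?of (free_gen j)) = (if j = k then \<one>\<^bsub>?ZF\<^esub> else \<zero>\<^bsub>?ZF\<^esub>)"
      using D that(1) unfolding is_discrete_fox_derivative_def by blast
    then show ?thesis using that(2) by (auto simp: group_ring_def)
  qed
  have step: "ring_pairing ?F (D (?of (free_gen j \<otimes>\<^bsub>?F\<^esub> u))) ?f
      = (if j = k then ?f u else 0) + ring_pairing ?F (D (?of u)) ?f"
    if j: "j \<in> {1..n}" and u: "u \<in> carrier ?F" for j u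
  proof -
    define e where "e g = (if j = k then ?of u g else 0)" for g
    have c: "D (?of (free_gen j \<otimes>\<^bsub>?F\<^esub> u)) g = e g + D (?of u) g" if g: "g \<in> carrier ?F" for g
    proof -
      have "g \<otimes>\<^bsub>?F\<^esub> inv\<^bsub>?F\<^esub> u = \<one>\<^bsub>?F\<^esub> \<longleftrightarrow> g = u"
        using g u by (metis F.inv_equality F.inv_inv F.inv_closed F.r_inv)
      then show ?thesis
        using prod[OF free_gen_closed[OF j] u g] gen[OF j, of "g \<otimes>\<^bsub>?F\<^esub> inv\<^bsub>?F\<^esub> u"] g u
        by (auto simp: e_def F.group_ring_of_apply)
    qed
    have "finite {g \<in> carrier ?F. e g \<noteq> 0}"
      using F.int_group_ring_finite_support[OF of, of u] by (rule rev_finite_subset) (auto simp: e_def)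
    then have "ring_pairing ?F (D (?of (free_gen j \<otimes>\<^bsub>?F\<^esub> u))) ?f
      = ring_pairing ?F e ?f + ring_pairing ?F (D (?of u)) ?f"
      using F.ring_pairing_add[OF _ fin c] by blast
    moreover have "ring_pairing ?F e ?f = (if j = k then ?f u else 0)"
    proof (cases "j = k")
      case True
      then have "e = ?of u" by (simp add: e_def fun_eq_iff)
      then show ?thesis using True F.ring_pairing_of[OF u, of ?f] by simp
    next
      case False
      then show ?thesis by (simp add: e_def ring_pairing_def)
    qed
    ultimately show ?thesis by simp
  qed
  have key: "[\<tau> (free_gen j \<otimes>\<^bsub>?F\<^esub> u) - \<tau> u = (if j = k then ?f u else 0)] (mod p)"
    if "j \<in> {1..n}" "u \<in> carrier ?F" for j u
    using \<tau>[of j u] that by (auto simp: cong_iff_dvd_diff)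
  show ?thesis
    using w
  proof (induction rule: free_group_induct)
    case one
    have "D (?of \<one>\<^bsub>?F\<^esub>) g = 0" if "g \<in> carrier ?F" for g
      using prod[OF F.one_closed F.one_closed that] that by simp
    then have "ring_pairing ?F (D (?of \<one>\<^bsub>?F\<^esub>)) ?f = 0" by (simp add: ring_pairing_def)
    then show ?case by simp
  next
    case (gen j u)
    show ?case
      using cong_add[OF key[OF gen(1,2)] gen(3)] unfolding step[OF gen(1,2)] by simp
  next
    case (inv_gen j u)
    define v where "v = inv\<^bsub>?F\<^esub> free_gen j \<otimes>\<^bsub>?F\<^esub> u"
    have v: "v \<in> carrier ?F" and u: "u = free_gen j \<otimes>\<^bsub>?F\<^esub> v"
      using inv_gen(1,2) free_gen_closed[of j n] by (auto simp: v_def F.m_assoc[symmetric])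
    have "[\<tau> u - \<tau> \<one>\<^bsub>?F\<^esub> - (\<tau> u - \<tau> v) = ring_pairing ?F (D (?of u)) ?f - (if j = k then ?f v else 0)] (mod p)"
      using cong_diff[OF inv_gen(3) key[OF inv_gen(1) v]] u by simp
    then show ?case
      unfolding v_def[symmetric] using step[OF inv_gen(1) v] u by simp
  qed
qed

text \<open>With the potential \<open>\<tau>\<close> extending \<open>\<phi>\<close>, the difference \<open>\<phi>(w) = \<tau>(w) - \<tau>(1)\<close> is obtained by pairing
  \<open>D(w)\<close> with \<open>u \<mapsto> \<tau>(x\<^sub>k u) - \<tau>(u)\<close>. The latter is invariant under \<open>K\<close>, since \<open>\<phi>\<close> cancels, so the pairing
  vanishes modulo \<open>p\<close> as soon as the image of \<open>D(w)\<close> in the group ring of the quotient by \<open>K\<close> does.\<close>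

lemma fox_derivative_mod_nonzero:
  fixes \<phi> :: "word \<Rightarrow> int" and p :: int
  assumes D: "is_discrete_fox_derivative n k D" and k: "k \<in> {1..n}"
    and K: "K \<lhd> free_group n" and A: "subgroup A (free_group n)"
    and gens: "\<And>j. j \<in> {1..n} - {k} \<Longrightarrow> free_gen j \<in> A"
    and hom: "\<And>x y. x \<in> K \<Longrightarrow> y \<in> K \<Longrightarrow> [\<phi> (x \<otimes>\<^bsub>free_group n\<^esub> y) = \<phi> x + \<phi> y] (mod p)"
    and conj: "\<And>a g. a \<in> A \<Longrightarrow> g \<in> carrier (free_group n) \<Longrightarrow>
        inv\<^bsub>free_group n\<^esub> g \<otimes>\<^bsub>free_group n\<^esub> a \<otimes>\<^bsub>free_group n\<^esub> g \<in> K \<Longrightarrow>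
        [\<phi> (inv\<^bsub>free_group n\<^esub> g \<otimes>\<^bsub>free_group n\<^esub> a \<otimes>\<^bsub>free_group n\<^esub> g) = 0] (mod p)"
    and w: "w \<in> K" "\<not> p dvd \<phi> w"
  obtains C where "\<not> p dvd (\<Sum>u\<in>{u \<in> carrier (free_group n).
        D (group_ring_of \<Z> (free_group n) w) u \<noteq> 0 \<and> K #>\<^bsub>free_group n\<^esub> u = C}.
          D (group_ring_of \<Z> (free_group n) w) u)"
proof (rule ccontr)
  assume none: "\<not> thesis"
  let ?F = "free_group n"
  let ?a = "D (group_ring_of \<Z> ?F w)"
  interpret F: group ?F by (rule group_free_group)
  interpret K: normal K ?F by (rule K)
  obtain \<tau> :: "word \<Rightarrow> int"
    where \<tau>K: "\<And>g k. g \<in> carrier ?F \<Longrightarrow> k \<in> K \<Longrightarrow> [\<tau> (g \<otimes>\<^bsub>?F\<^esub> k) = \<tau> g + \<phi> k] (mod p)"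
      and \<tau>A: "\<And>a g. a \<in> A \<Longrightarrow> g \<in> carrier ?F \<Longrightarrow> [\<tau> (a \<otimes>\<^bsub>?F\<^esub> g) = \<tau> g] (mod p)"
    using F.double_coset_extension[OF A K.subgroup_axioms hom conj] by blast
  let ?f = "\<lambda>u. \<tau> (free_gen k \<otimes>\<^bsub>?F\<^esub> u) - \<tau> u"
  have xk: "free_gen k \<in> carrier ?F" using free_gen_closed[OF k] .
  have "group_ring_of \<Z> ?F w \<in> carrier (group_ring \<Z> ?F)" by (rule F.group_ring_of_closed) simp_all
  then have fin: "finite {u \<in> carrier ?F. ?a u \<noteq> 0}"
    using D F.int_group_ring_finite_support unfolding is_discrete_fox_derivative_def by blast
  have "[ring_pairing ?F ?a ?f = 0] (mod p)"
  proof (rule F.ring_pairing_cong_0[OF fin, where q = "\<lambda>u. K #>\<^bsub>?F\<^esub> u"])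
    show "p dvd (\<Sum>u\<in>{u \<in> carrier ?F. ?a u \<noteq> 0 \<and> K #>\<^bsub>?F\<^esub> u = C}. ?a u)" for C
      using none that by blast
    fix g h assume g: "g \<in> carrier ?F" and h: "h \<in> carrier ?F" and eq: "K #>\<^bsub>?F\<^esub> g = K #>\<^bsub>?F\<^esub> h"
    define c where "c = inv\<^bsub>?F\<^esub> h \<otimes>\<^bsub>?F\<^esub> (g \<otimes>\<^bsub>?F\<^esub> inv\<^bsub>?F\<^esub> h) \<otimes>\<^bsub>?F\<^esub> h"
    have "g \<otimes>\<^bsub>?F\<^esub> inv\<^bsub>?F\<^esub> h \<in> K" using F.rcos_eq_iff[OF K.subgroup_axioms g h] eq by simp
    then have c: "c \<in> K" unfolding c_def by (rule K.inv_op_closed1[OF h])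
    have gc: "g = h \<otimes>\<^bsub>?F\<^esub> c"
      unfolding c_def using g h by (simp add: F.m_assoc) (simp add: F.m_assoc[symmetric])
    have "free_gen k \<otimes>\<^bsub>?F\<^esub> g = free_gen k \<otimes>\<^bsub>?F\<^esub> h \<otimes>\<^bsub>?F\<^esub> c"
      using gc h c xk by (simp add: F.m_assoc)
    then have "[?f g = \<tau> (free_gen k \<otimes>\<^bsub>?F\<^esub> h) + \<phi> c - (\<tau> h + \<phi> c)] (mod p)"
      using cong_diff[OF \<tau>K[OF _ c, of "free_gen k \<otimes>\<^bsub>?F\<^esub> h"] \<tau>K[OF h c]] gc h xk by simp
    then show "[?f g = ?f h] (mod p)" by simp
  qed
  moreover have "[\<tau> w - \<tau> \<one>\<^bsub>?F\<^esub> = ring_pairing ?F ?a ?f] (mod p)"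
    using \<tau>A[OF gens] w(1) by (intro fox_fundamental_formula[OF D k]) auto
  moreover have "[\<tau> w = \<tau> \<one>\<^bsub>?F\<^esub> + \<phi> w] (mod p)" using \<tau>K[OF F.one_closed w(1)] w(1) by simp
  ultimately have "[\<phi> w = 0] (mod p)"
    by (smt (verit) cong_diff cong_refl cong_sym cong_trans add_diff_cancel_left')
  then show False using w(2) by (simp add: cong_0_iff)
qed

section \<open>Completed group rings\<close>

lemma padic_int_simps:
  "a \<in> carrier (padic_int p) \<longleftrightarrow> (\<forall>m. a m \<in> {0..<int p ^ m} \<and> a (Suc m) mod int p ^ m = a m)"
  "a \<oplus>\<^bsub>padic_int p\<^esub> b = (\<lambda>m. (a m + b m) mod int p ^ m)"
  "\<zero>\<^bsub>padic_int p\<^esub> = (\<lambda>m. 0)"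
  "\<one>\<^bsub>padic_int p\<^esub> = (\<lambda>m. 1 mod int p ^ m)"
  by (simp_all add: padic_int_def)

lemma group_ring_carrier_PiE: "a \<in> carrier (group_ring R G) \<Longrightarrow> a \<in> carrier G \<rightarrow>\<^sub>E carrier R"
  by (simp add: group_ring_def)

context
  fixes p :: nat
  assumes p: "Factorial_Ring.prime p"
begin

lemma padic_add_closed:
  assumes a: "a \<in> carrier (padic_int p)" and b: "b \<in> carrier (padic_int p)"
  shows "a \<oplus>\<^bsub>padic_int p\<^esub> b \<in> carrier (padic_int p)"
  unfolding padic_int_simps
proof (intro allI conjI)
  fix m
  show "(a m + b m) mod int p ^ m \<in> {0..<int p ^ m}" using prime_gt_0_nat[OF p] by simp
  have "(a (Suc m) + b (Suc m)) mod int p ^ Suc m mod int p ^ m = (a (Suc m) + b (Suc m)) mod int p ^ m"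
    by (intro mod_mod_cancel) simp
  also have "\<dots> = (a (Suc m) mod int p ^ m + b (Suc m) mod int p ^ m) mod int p ^ m"
    by (simp only: mod_add_eq)
  also have "\<dots> = (a m + b m) mod int p ^ m" using a b by (simp add: padic_int_simps)
  finally show "(a (Suc m) + b (Suc m)) mod int p ^ Suc m mod int p ^ m = (a m + b m) mod int p ^ m" .
qed

lemma padic_of_int_closed: "padic_of_int p z \<in> carrier (padic_int p)"
  using prime_gt_0_nat[OF p] mod_mod_cancel[of "int p ^ m" "int p ^ Suc m" z for m]
  by (simp add: padic_int_simps padic_of_int_def)

lemma padic_of_int_simps: "padic_of_int p 0 = \<zero>\<^bsub>padic_int p\<^esub>" "padic_of_int p 1 = \<one>\<^bsub>padic_int p\<^esub>"
  by (simp_all add: padic_int_simps padic_of_int_def)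

lemma padic_zero_closed: "\<zero>\<^bsub>padic_int p\<^esub> \<in> carrier (padic_int p)"
  and padic_one_closed: "\<one>\<^bsub>padic_int p\<^esub> \<in> carrier (padic_int p)"
  using padic_of_int_closed[of 0] padic_of_int_closed[of 1] by (simp_all only: padic_of_int_simps)

lemma padic_abelian_monoid: "abelian_monoid (padic_int p)"
proof (rule abelian_monoidI)
  fix a b c assume a: "a \<in> carrier (padic_int p)"
  show "\<zero>\<^bsub>padic_int p\<^esub> \<oplus>\<^bsub>padic_int p\<^esub> a = a"
    using a by (simp add: padic_int_simps fun_eq_iff)
  show "a \<oplus>\<^bsub>padic_int p\<^esub> b = b \<oplus>\<^bsub>padic_int p\<^esub> a"
    by (simp add: padic_int_simps add.commute)
  show "a \<oplus>\<^bsub>padic_int p\<^esub> b \<oplus>\<^bsub>padic_int p\<^esub> c = a \<oplus>\<^bsub>padic_int p\<^esub> (b \<oplus>\<^bsub>padic_int p\<^esub> c)"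
    by (simp add: padic_int_simps mod_add_left_eq mod_add_right_eq add.assoc)
qed (rule padic_add_closed padic_zero_closed; assumption)+

interpretation Zp: abelian_monoid "padic_int p" by (rule padic_abelian_monoid)

lemma padic_finsum_apply:
  assumes "finite A" "\<And>x. x \<in> A \<Longrightarrow> f x \<in> carrier (padic_int p)"
  shows "finsum (padic_int p) f A m = (\<Sum>x\<in>A. f x m) mod int p ^ m"
  using assms
proof (induction A rule: finite_induct)
  case empty
  then show ?case by (simp add: padic_int_simps)
next
  case (insert x A)
  have "finsum (padic_int p) f (insert x A) = f x \<oplus>\<^bsub>padic_int p\<^esub> finsum (padic_int p) f A"
    using insert by (intro Zp.finsum_insert) auto
  then show ?case using insert by (simp add: padic_int_simps mod_add_right_eq)
qed

lemma padic_one_neq_zero: "\<one>\<^bsub>padic_int p\<^esub> \<noteq> \<zero>\<^bsub>padic_int p\<^esub>"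
proof
  assume "\<one>\<^bsub>padic_int p\<^esub> = \<zero>\<^bsub>padic_int p\<^esub>"
  then have "1 mod int p ^ 1 = 0" unfolding padic_int_simps by metis
  then show False using prime_gt_1_nat[OF p] by simp
qed

lemma topspace_padic: "topspace (padic_topology p) = carrier (padic_int p)"
  by (simp add: padic_topology_def)

lemma padic_group_ring_of_closed:
  "Group.group G \<Longrightarrow> group_ring_of (padic_int p) G x \<in> carrier (group_ring (padic_int p) G)"
  by (rule group.group_ring_of_closed[OF _ padic_one_closed padic_zero_closed])

lemma group_ring_map_of:
  assumes G: "Group.group G" and x: "x \<in> carrier G"
  shows "group_ring_map (padic_int p) G G' h (group_ring_of (padic_int p) G x)
       = group_ring_of (padic_int p) G' (h x)"
proof -
  interpret group G by (rule G)
  have "(\<Oplus>\<^bsub>padic_int p\<^esub>u\<in>{u \<in> carrier G. group_ring_of (padic_int p) G x u \<noteq> \<zero>\<^bsub>padic_int p\<^esub> \<and> h u = y}.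
           group_ring_of (padic_int p) G x u) = (if y = h x then \<one>\<^bsub>padic_int p\<^esub> else \<zero>\<^bsub>padic_int p\<^esub>)" for y
  proof -
    have "{u \<in> carrier G. group_ring_of (padic_int p) G x u \<noteq> \<zero>\<^bsub>padic_int p\<^esub> \<and> h u = y} = (if y = h x then {x} else {})"
      using x padic_one_neq_zero by (auto simp: group_ring_of_apply split: if_splits)
    then show ?thesis
      using x padic_one_closed by (auto simp: group_ring_of_apply)
  qed
  then show ?thesis
    unfolding group_ring_map_def group_ring_of_def[of _ G'] by (intro restrict_ext) simp
qed

lemma group_ring_map_inj_zero:
  assumes a: "\<And>x. x \<in> carrier G \<Longrightarrow> a x \<in> carrier (padic_int p)"
    and h: "inj_on h (carrier G)" "\<And>x. x \<in> carrier G \<Longrightarrow> h x \<in> carrier G'"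
    and zero: "\<And>y. y \<in> carrier G' \<Longrightarrow> group_ring_map (padic_int p) G G' h a y = \<zero>\<^bsub>padic_int p\<^esub>"
    and x: "x \<in> carrier G"
  shows "a x = \<zero>\<^bsub>padic_int p\<^esub>"
proof (rule ccontr)
  assume ne: "a x \<noteq> \<zero>\<^bsub>padic_int p\<^esub>"
  have "{u \<in> carrier G. a u \<noteq> \<zero>\<^bsub>padic_int p\<^esub> \<and> h u = h x} = {x}"
    using ne x h(1) by (auto dest: inj_onD)
  then have "group_ring_map (padic_int p) G G' h a (h x) = (\<Oplus>\<^bsub>padic_int p\<^esub>u\<in>{x}. a u)"
    unfolding group_ring_map_def using h(2)[OF x] by simp
  also have "\<dots> = a x" using a[OF x] by simp
  finally show False using zero[OF h(2)[OF x]] ne by simp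
qed

text \<open>The entry of a \<open>p\<close>-adic integer at index \<open>1\<close> is its residue modulo \<open>p\<close>.\<close>

lemma group_ring_map_int_mod_p:
  assumes a: "finite {u \<in> carrier G. a u \<noteq> 0}" and y: "y \<in> carrier G'"
  shows "group_ring_map (padic_int p) G G' h (\<lambda>u\<in>carrier G. padic_of_int p (a u)) y 1
       = (\<Sum>u\<in>{u \<in> carrier G. a u \<noteq> 0 \<and> h u = y}. a u) mod int p"
proof -
  let ?S = "{u \<in> carrier G. a u \<noteq> 0 \<and> h u = y}"
  define b where "b = (\<lambda>u\<in>carrier G. padic_of_int p (a u))"
  have b: "b u = padic_of_int p (a u)" if "u \<in> carrier G" for u using that by (simp add: b_def)
  let ?S' = "{u \<in> carrier G. b u \<noteq> \<zero>\<^bsub>padic_int p\<^esub> \<and> h u = y}"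
  have S: "finite ?S" by (rule finite_subset[OF _ a]) auto
  have S': "?S' \<subseteq> ?S" using padic_of_int_simps(1) b by auto
  have bc: "b u \<in> carrier (padic_int p)" if "u \<in> ?S'" for u
    using that b padic_of_int_closed by simp
  have "group_ring_map (padic_int p) G G' h b y 1 = (\<Sum>u\<in>?S'. b u 1) mod int p ^ 1"
    using padic_finsum_apply[OF finite_subset[OF S' S] bc, where m = 1] y by (simp add: group_ring_map_def)
  also have "(\<Sum>u\<in>?S'. b u 1) = (\<Sum>u\<in>?S'. a u mod int p)"
    by (intro sum.cong) (auto simp: padic_of_int_def b)
  also have "\<dots> = (\<Sum>u\<in>?S. a u mod int p)"
  proof (rule sum.mono_neutral_left[OF S S'], rule ballI)
    fix u assume "u \<in> ?S - ?S'"
    then have "padic_of_int p (a u) = \<zero>\<^bsub>padic_int p\<^esub>" using b by auto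
    then have "padic_of_int p (a u) 1 = 0" by (simp add: padic_int_simps)
    then show "a u mod int p = 0" by (simp add: padic_of_int_def)
  qed
  finally have "group_ring_map (padic_int p) G G' h b y 1 = (\<Sum>u\<in>?S. a u mod int p) mod int p ^ 1" .
  then show ?thesis unfolding b_def by (simp only: mod_sum_eq power_one_right)
qed

lemma completed_group_ring_of_closed:
  assumes G: "Group.group G" and g: "g \<in> carrier G"
  shows "completed_group_ring_of p G T g \<in> carrier (completed_group_ring p G T)"
proof -
  interpret group G by (rule G)
  have ons: "U \<lhd> G" "Group.group (G Mod U)" "U #>\<^bsub>G\<^esub> g \<in> carrier (G Mod U)"
    if "U \<in> open_normal_subgroups G T" for U
    using that g normal.factorgroup_is_group by (auto simp: open_normal_subgroups_def carrier_FactGroup)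
  have "group_ring_map (padic_int p) (G Mod U) (G Mod V) (\<lambda>C. V <#>\<^bsub>G\<^esub> C)
          (group_ring_of (padic_int p) (G Mod U) (U #>\<^bsub>G\<^esub> g)) = group_ring_of (padic_int p) (G Mod V) (V #>\<^bsub>G\<^esub> g)"
    if UV: "U \<in> open_normal_subgroups G T" "V \<in> open_normal_subgroups G T" "U \<subseteq> V" for U V
    using group_ring_map_of[OF ons(2,3)[OF UV(1)]] subgroup_mult_rcos[OF _ _ UV(3) g] ons(1) UV normal_imp_subgroup
    by metis
  then show ?thesis
    using padic_group_ring_of_closed[OF ons(2)]
    by (auto simp: completed_group_ring_def completed_group_ring_of_def)
qed

lemma completed_group_ring_component:
  "a \<in> carrier (completed_group_ring p G T) \<Longrightarrow> U \<in> open_normal_subgroups G T \<Longrightarrow>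
     a U \<in> carrier (group_ring (padic_int p) (G Mod U))"
  by (auto simp: completed_group_ring_def)

lemma completed_group_ring_coeff:
  "a \<in> carrier (completed_group_ring p G T) \<Longrightarrow> U \<in> open_normal_subgroups G T \<Longrightarrow>
     C \<in> carrier (G Mod U) \<Longrightarrow> a U C \<in> carrier (padic_int p)"
  using group_ring_carrier_PiE[OF completed_group_ring_component] by blast

lemma topspace_completed_group_ring:
  "topspace (completed_group_ring_topology p G T) = carrier (completed_group_ring p G T)"
proof -
  have "carrier (completed_group_ring p G T) \<subseteq>
      (\<Pi>\<^sub>E U \<in> open_normal_subgroups G T. carrier (G Mod U) \<rightarrow>\<^sub>E carrier (padic_int p))"
  proof
    fix a assume a: "a \<in> carrier (completed_group_ring p G T)"
    then have "a \<in> extensional (open_normal_subgroups G T)"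
      by (auto simp: completed_group_ring_def PiE_def)
    then show "a \<in> (\<Pi>\<^sub>E U \<in> open_normal_subgroups G T. carrier (G Mod U) \<rightarrow>\<^sub>E carrier (padic_int p))"
      using group_ring_carrier_PiE[OF completed_group_ring_component[OF a]] by (auto simp: PiE_iff)
  qed
  then show ?thesis
    by (auto simp: completed_group_ring_topology_def topspace_padic)
qed

lemma openin_completed_group_ring_level:
  assumes V: "V \<in> open_normal_subgroups G T" and fin: "finite (carrier (G Mod V))"
  shows "openin (completed_group_ring_topology p G T)
           {a \<in> carrier (completed_group_ring p G T). \<forall>C\<in>carrier (G Mod V). a V C m = c C}"
proof -
  let ?X = "completed_group_ring_topology p G T"
  have coeff: "continuous_map ?X (discrete_topology UNIV) (\<lambda>a. a V C m)" if C: "C \<in> carrier (G Mod V)" for C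
  proof -
    have 1: "continuous_map ?X (product_topology (\<lambda>C. padic_topology p) (carrier (G Mod V))) (\<lambda>a. a V)"
      unfolding completed_group_ring_topology_def
      using V by (intro continuous_map_from_subtopology continuous_map_product_projection)
    have 2: "continuous_map (product_topology (\<lambda>C. padic_topology p) (carrier (G Mod V))) (padic_topology p) (\<lambda>b. b C)"
      using C by (intro continuous_map_product_projection)
    have 3: "continuous_map (padic_topology p) (discrete_topology UNIV) (\<lambda>z. z m)"
      unfolding padic_topology_def by (intro continuous_map_from_subtopology continuous_map_product_projection) simp
    show ?thesis
      using continuous_map_compose[OF continuous_map_compose[OF 1 2] 3] by (simp add: o_def)
  qed
  have one: "openin ?X {a \<in> topspace ?X. a V C m = c C}" if "C \<in> carrier (G Mod V)" for C
    using openin_continuous_map_preimage[OF coeff[OF that], of "{c C}"] by simp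
  have "openin ?X (topspace ?X \<inter> (\<Inter>C\<in>carrier (G Mod V). {a \<in> topspace ?X. a V C m = c C}))"
  proof (cases "carrier (G Mod V) = {}")
    case False
    then show ?thesis using fin one by (intro openin_Int openin_topspace openin_Inter) auto
  qed simp
  moreover have "topspace ?X \<inter> (\<Inter>C\<in>carrier (G Mod V). {a \<in> topspace ?X. a V C m = c C})
      = {a \<in> carrier (completed_group_ring p G T). \<forall>C\<in>carrier (G Mod V). a V C m = c C}"
    unfolding topspace_completed_group_ring by auto
  ultimately show ?thesis by simp
qed

end

context pro_p_setting
begin

text \<open>The component at \<open>U\<close> depends only on the coset of \<open>U\<close>, which is locally constant.\<close>

lemma continuous_completed_group_ring_of:
  "continuous_map T (completed_group_ring_topology p Q T) (completed_group_ring_of p Q T)"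
proof -
  have comp: "continuous_map T (product_topology (\<lambda>C. padic_topology p) (carrier (Q Mod U)))
      (\<lambda>f. completed_group_ring_of p Q T f U)" if U: "U \<in> open_normal_subgroups Q T" for U
  proof -
    have Un: "U \<lhd> Q" and Uo: "openin T U" using U by (auto simp: open_normal_subgroups_def)
    have "continuous_map T (discrete_topology (carrier (Q Mod U))) (\<lambda>f. U #>\<^bsub>Q\<^esub> f)"
      unfolding continuous_map_def
    proof (intro conjI allI impI)
      show "(\<lambda>f. U #>\<^bsub>Q\<^esub> f) \<in> topspace T \<rightarrow> topspace (discrete_topology (carrier (Q Mod U)))"
        by (auto simp: carrier_FactGroup)
      fix S :: "('a set \<Rightarrow> 'a set) set set"
      obtain N where N: "N \<in> \<N>"
        "\<And>f g. f \<in> carrier Q \<Longrightarrow> g \<in> carrier Q \<Longrightarrow> f N = g N \<Longrightarrow> U #>\<^bsub>Q\<^esub> f = U #>\<^bsub>Q\<^esub> g"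
        using open_subgroup_component[OF normal_imp_subgroup[OF Un] Uo] by blast
      have "{f \<in> topspace T. U #>\<^bsub>Q\<^esub> f \<in> S}
          = {f \<in> carrier Q. f N \<in> (\<lambda>g. g N) ` {g \<in> carrier Q. U #>\<^bsub>Q\<^esub> g \<in> S}}" (is "?L = ?R")
      proof (intro equalityI subsetI)
        fix f assume "f \<in> ?R"
        then obtain g where "f \<in> carrier Q" "g \<in> carrier Q" "U #>\<^bsub>Q\<^esub> g \<in> S" "f N = g N" by blast
        then show "f \<in> ?L" using N(2)[of f g] by simp
      qed auto
      then show "openin T {f \<in> topspace T. U #>\<^bsub>Q\<^esub> f \<in> S}"
        by (simp only: clopen_component(1)[OF N(1)])
    qed
    moreover have "continuous_map (discrete_topology (carrier (Q Mod U)))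
        (product_topology (\<lambda>C. padic_topology p) (carrier (Q Mod U))) (group_ring_of (padic_int p) (Q Mod U))"
      using group_ring_carrier_PiE[OF padic_group_ring_of_closed[OF prime_p normal.factorgroup_is_group[OF Un]]]
      by (auto simp: topspace_padic[OF prime_p])
    ultimately have "continuous_map T (product_topology (\<lambda>C. padic_topology p) (carrier (Q Mod U)))
        (group_ring_of (padic_int p) (Q Mod U) \<circ> (\<lambda>f. U #>\<^bsub>Q\<^esub> f))"
      by (rule continuous_map_compose)
    then show ?thesis using U by (simp add: completed_group_ring_of_def o_def)
  qed
  have "completed_group_ring_of p Q T ` topspace T \<subseteq> carrier (completed_group_ring p Q T)"
    using completed_group_ring_of_closed[OF prime_p group_Q] by auto
  then show ?thesis
    unfolding completed_group_ring_topology_def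
    using comp by (auto simp: continuous_map_in_subtopology continuous_map_componentwise completed_group_ring_of_def)
qed

text \<open>Only finitely many residues are involved, and each is a locally constant function of \<open>g\<close>.
  This replaces an element of the completion by a nearby element of \<open>G\<close>.\<close>

lemma approximate_mod_p:
  assumes d: "continuous_map (completed_group_ring_topology p Q T) (completed_group_ring_topology p Q T) d"
    and r: "r \<in> carrier Q"
    and V: "V \<in> open_normal_subgroups Q T" "finite (carrier (Q Mod V))"
  obtains N where "N \<in> \<N>"
    "\<And>g C. g \<in> carrier Q \<Longrightarrow> g N = r N \<Longrightarrow> C \<in> carrier (Q Mod V) \<Longrightarrow>
       d (completed_group_ring_of p Q T g) V C 1 = d (completed_group_ring_of p Q T r) V C 1"
proof -
  let ?X = "completed_group_ring_topology p Q T"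
  let ?O = "{a \<in> carrier (completed_group_ring p Q T).
      \<forall>C\<in>carrier (Q Mod V). a V C 1 = d (completed_group_ring_of p Q T r) V C 1}"
  have cont: "continuous_map T ?X (d \<circ> completed_group_ring_of p Q T)"
    using continuous_map_compose[OF continuous_completed_group_ring_of d] .
  define S where "S = {g \<in> topspace T. (d \<circ> completed_group_ring_of p Q T) g \<in> ?O}"
  have "openin T S" unfolding S_def
    by (rule openin_continuous_map_preimage[OF cont openin_completed_group_ring_level[OF prime_p V]])
  moreover have "r \<in> S"
    using r continuous_map_image_subset_topspace[OF cont]
    by (auto simp: S_def topspace_completed_group_ring[OF prime_p])
  ultimately obtain N where N: "N \<in> \<N>" "\<And>g. g \<in> carrier Q \<Longrightarrow> g N = r N \<Longrightarrow> g \<in> S"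
    using openin_T_basis[of S r] by blast
  show thesis
    by (rule that[OF N(1)]) (use N(2) in \<open>auto simp: S_def\<close>)
qed

end

text \<open>By \<open>R \<subseteq> V\<close>, the group \<open>G/V\<close> is isomorphic to \<open>(G/R)/(V/R)\<close>. So the component of \<open>a\<close> at \<open>V\<close> is
  determined by the component at \<open>V/R\<close> of the image of \<open>a\<close>.\<close>

lemma (in group) completed_group_ring_map_quotient_zero:
  assumes p: "Factorial_Ring.prime p" and T: "topspace T = carrier G"
    and R: "R \<lhd> G" and V: "V \<in> open_normal_subgroups G T" and RV: "R \<subseteq> V"
    and a: "a \<in> carrier (completed_group_ring p G T)"
    and zero: "completed_group_ring_map p G (G Mod R) (quotient_group_topology G T R) (\<lambda>g. R #> g) a
      = \<zero>\<^bsub>completed_group_ring p (G Mod R) (quotient_group_topology G T R)\<^esub>"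
    and C: "C \<in> carrier (G Mod V)"
  shows "a V C = \<zero>\<^bsub>padic_int p\<^esub>"
proof -
  let ?q = "\<lambda>g. R #> g"
  let ?T' = "quotient_group_topology G T R"
  have Vn: "V \<lhd> G" and Vo: "openin T V" using V by (auto simp: open_normal_subgroups_def)
  interpret R: normal R G by (rule R)
  interpret V: normal V G by (rule Vn)
  interpret GR: group "G Mod R" by (rule R.factorgroup_is_group)
  interpret q: group_hom G "G Mod R" ?q
    by (intro group_hom.intro is_group GR.is_group group_hom_axioms.intro R.r_coset_hom_Mod)
  define W where "W = ?q ` V"
  have W: "W \<lhd> G Mod R"
    unfolding W_def by (intro V.surj_hom_normal_subgroup q.group_hom_axioms) (simp add: carrier_FactGroup)
  have Wsub: "subgroup W (G Mod R)" by (rule normal_imp_subgroup[OF W])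
  have q_mem: "?q g \<in> W \<longleftrightarrow> g \<in> V" if g: "g \<in> carrier G" for g
  proof
    assume "?q g \<in> W"
    then obtain v where v: "v \<in> V" "R #> g = R #> v" by (auto simp: W_def)
    then have "g \<otimes> inv v \<in> V" using rcos_eq_iff[OF R.subgroup_axioms g] RV by auto
    then have "g \<otimes> inv v \<otimes> v \<in> V" using v(1) V.m_closed by blast
    then show "g \<in> V" using g v(1) by (simp add: m_assoc)
  qed (simp add: W_def)
  have pre: "{g \<in> carrier G. ?q g \<in> W} = V" using q_mem V.subset by auto
  have "openin ?T' W"
    unfolding openin_quotient_group_topology[OF T] pre using Vo subgroup.subset[OF Wsub] by simp
  then have Wons: "W \<in> open_normal_subgroups (G Mod R) ?T'" using W by (simp add: open_normal_subgroups_def)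
  let ?h = "\<lambda>C. W <#>\<^bsub>G Mod R\<^esub> (?q ` C)"
  have h: "?h (V #> g) = W #>\<^bsub>G Mod R\<^esub> ?q g" if g: "g \<in> carrier G" for g
  proof -
    have "?q ` (V #> g) = W #>\<^bsub>G Mod R\<^esub> ?q g"
    proof -
      have "?q ` (V #> g) = (\<Union>v\<in>V. {?q (v \<otimes> g)})" unfolding r_coset_def[of G V] by blast
      also have "\<dots> = (\<Union>v\<in>V. {?q v \<otimes>\<^bsub>G Mod R\<^esub> ?q g})"
        using R.rcos_sum[OF _ g] V.subset by (intro SUP_cong refl) (simp add: subsetD)
      also have "\<dots> = W #>\<^bsub>G Mod R\<^esub> ?q g" unfolding r_coset_def[of "G Mod R" W] by (simp add: W_def del: mult_FactGroup)
      finally show ?thesis .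
    qed
    then show ?thesis
      using GR.subgroup_mult_rcos[OF Wsub Wsub subset_refl] g by simp
  qed
  show ?thesis
  proof (rule group_ring_map_inj_zero[OF p _ _ _ _ C])
    show "a V x \<in> carrier (padic_int p)" if "x \<in> carrier (G Mod V)" for x
      using completed_group_ring_coeff[OF p a V that] .
    show "inj_on ?h (carrier (G Mod V))"
    proof (rule inj_onI)
      fix x y assume "x \<in> carrier (G Mod V)" "y \<in> carrier (G Mod V)" and eq: "?h x = ?h y"
      then obtain g g' where g: "g \<in> carrier G" "x = V #> g" "g' \<in> carrier G" "y = V #> g'"
        by (auto simp: carrier_FactGroup)
      then have "?q g \<otimes>\<^bsub>G Mod R\<^esub> inv\<^bsub>G Mod R\<^esub> ?q g' \<in> W"
        using GR.rcos_eq_iff[OF Wsub q.hom_closed q.hom_closed] eq h by metis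
      then have "?q (g \<otimes> inv g') \<in> W" using g by (metis q.hom_inv q.hom_mult inv_closed)
      then have "g \<otimes> inv g' \<in> V" by (rule iffD1[OF q_mem, rotated]) (use g in simp)
      then show "x = y" using rcos_eq_iff[OF V.subgroup_axioms] g by simp
    qed
    show "?h x \<in> carrier (G Mod R Mod W)" if "x \<in> carrier (G Mod V)" for x
      using that h q.hom_closed by (auto simp: carrier_FactGroup[of G V] carrier_FactGroup[of "G Mod R" W])
    fix y assume y: "y \<in> carrier (G Mod R Mod W)"
    have "completed_group_ring_map p G (G Mod R) ?T' ?q a W = group_ring_map (padic_int p) (G Mod V) (G Mod R Mod W) ?h (a V)"
      unfolding completed_group_ring_map_def using Wons pre by simp
    moreover have "\<zero>\<^bsub>completed_group_ring p (G Mod R) ?T'\<^esub> W y = \<zero>\<^bsub>padic_int p\<^esub>"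
      using Wons y by (simp add: completed_group_ring_def group_ring_def)
    ultimately show "group_ring_map (padic_int p) (G Mod V) (G Mod R Mod W) ?h (a V) y = \<zero>\<^bsub>padic_int p\<^esub>"
      using zero by metis
  qed
qed

lemma int_free_group_ring_embedding_of:
  assumes p: "Factorial_Ring.prime p" and w: "w \<in> carrier (free_group n)"
  shows "int_free_group_ring_embedding p n (group_ring_of \<Z> (free_group n) w)
    = completed_group_ring_of p (free_pro_p p n) (free_pro_p_topology p n) (completion_map p (free_group n) w)"
proof -
  interpret F: group "free_group n" by (rule group_free_group)
  have "(\<lambda>v\<in>carrier (free_group n). padic_of_int p (group_ring_of \<Z> (free_group n) w v))
      = group_ring_of (padic_int p) (free_group n) w"
    unfolding group_ring_of_def[of "padic_int p"]
    by (intro restrict_ext) (simp add: F.group_ring_of_apply padic_of_int_simps[OF p])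
  then show ?thesis
    unfolding int_free_group_ring_embedding_def completed_group_ring_of_def
    by (simp add: group_ring_map_of[OF p group_free_group w])
qed

section \<open>Non-vanishing of the Fox derivative\<close>

theorem mainTheorem2:
  fixes p n :: nat
    and r :: "word set \<Rightarrow> word set"
    and R H :: "(word set \<Rightarrow> word set) set"
    and d :: "nat \<Rightarrow> ((word set \<Rightarrow> word set) set \<Rightarrow> (word set \<Rightarrow> word set) set \<Rightarrow> nat \<Rightarrow> int) \<Rightarrow>
                   ((word set \<Rightarrow> word set) set \<Rightarrow> (word set \<Rightarrow> word set) set \<Rightarrow> nat \<Rightarrow> int)"
  assumes "Factorial_Ring.prime p" and "n \<ge> 1"
    and "r \<in> carrier (free_pro_p p n)"
    and "r \<noteq> \<one>\<^bsub>free_pro_p p n\<^esub>"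
    and "R = closed_normal_subgroup_generated (free_pro_p p n) (free_pro_p_topology p n) {r}"
    and "H = closed_subgroup_generated (free_pro_p p n) (free_pro_p_topology p n)
               (free_pro_p_gen p n ` {1..n - 1})"
    and "\<forall>k \<in> {1..n}. is_fox_derivative p n k (d k)"
    and "H \<inter> R = {\<one>\<^bsub>free_pro_p p n\<^esub>}"
  shows "completed_group_ring_map p (free_pro_p p n) (free_pro_p p n Mod R)
           (quotient_group_topology (free_pro_p p n) (free_pro_p_topology p n) R)
           (\<lambda>g. R #>\<^bsub>free_pro_p p n\<^esub> g)
           (d n (completed_group_ring_of p (free_pro_p p n) (free_pro_p_topology p n) r))
         \<noteq> \<zero>\<^bsub>completed_group_ring p (free_pro_p p n Mod R)
             (quotient_group_topology (free_pro_p p n) (free_pro_p_topology p n) R)\<^esub>"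
proof
  assume zero: "completed_group_ring_map p (free_pro_p p n) (free_pro_p p n Mod R)
           (quotient_group_topology (free_pro_p p n) (free_pro_p_topology p n) R)
           (\<lambda>g. R #>\<^bsub>free_pro_p p n\<^esub> g)
           (d n (completed_group_ring_of p (free_pro_p p n) (free_pro_p_topology p n) r))
         = \<zero>\<^bsub>completed_group_ring p (free_pro_p p n Mod R)
             (quotient_group_topology (free_pro_p p n) (free_pro_p_topology p n) R)\<^esub>"
  let ?F = "free_group n"
  interpret pro_p_setting ?F p
    by (intro pro_p_setting.intro pro_p_setting_axioms.intro group_free_group assms(1))
  note unfolds = free_pro_p_def free_pro_p_topology_def free_pro_p_gen_def
  have r: "r \<in> carrier Q" "r \<noteq> \<one>\<^bsub>Q\<^esub>" and R: "R = closed_normal_subgroup_generated Q T {r}"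
    and H: "H = closed_subgroup_generated Q T ((\<lambda>j. completion_map p ?F (free_gen j)) ` {1..n - 1})"
    and HR: "H \<inter> R = {\<one>\<^bsub>Q\<^esub>}"
    using assms(3-6,8) unfolding unfolds by simp_all
  have n: "n \<in> {1..n}" using assms(2) by simp
  have d: "continuous_map (completed_group_ring_topology p Q T) (completed_group_ring_topology p Q T) (d n)"
    using assms(7) n unfolding is_fox_derivative_def unfolds by blast
  obtain D where D: "is_discrete_fox_derivative n n D"
    and dD: "\<And>a. a \<in> carrier (group_ring \<Z> ?F) \<Longrightarrow>
       d n (int_free_group_ring_embedding p n a) = int_free_group_ring_embedding p n (D a)"
    using assms(7) n unfolding is_fox_derivative_def by blast
  have gens: "(\<lambda>j. completion_map p ?F (free_gen j)) ` {1..n - 1} \<subseteq> carrier Q"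
    using completion_map_closed free_gen_closed by auto
  have Hsub: "subgroup H Q" and Hc: "closedin T H"
    unfolding H using closed_hull_subgroup[OF gens] by auto
  have genH: "completion_map p ?F (free_gen j) \<in> H" if "j \<in> {1..n} - {n}" for j
  proof -
    have "(\<lambda>j. completion_map p ?F (free_gen j)) ` {1..n - 1} \<subseteq> H"
      unfolding H closed_subgroup_generated_def by (rule hull_subset)
    then show ?thesis using that by auto
  qed
  have rQ: "{r} \<subseteq> carrier Q" using r by simp
  have Rn: "R \<lhd> Q" unfolding R using closed_hull_normal(1)[OF rQ] .
  have rR: "r \<in> R" using hull_subset_closed_normal(1)[of "{r}"] R by blast
  obtain N and \<phi> :: "word \<Rightarrow> int" where N: "N \<in> \<N>"
    and hom: "\<And>x y. x \<in> carrier ?F \<Longrightarrow> y \<in> carrier ?F \<Longrightarrow> N #>\<^bsub>?F\<^esub> x \<in> (\<lambda>g. g N) ` R \<Longrightarrow>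
          N #>\<^bsub>?F\<^esub> y \<in> (\<lambda>g. g N) ` R \<Longrightarrow> [\<phi> (x \<otimes>\<^bsub>?F\<^esub> y) = \<phi> x + \<phi> y] (mod int p)"
    and conj: "\<And>a g. a \<in> carrier ?F \<Longrightarrow> completion_map p ?F a \<in> H \<Longrightarrow> g \<in> carrier ?F \<Longrightarrow>
          N #>\<^bsub>?F\<^esub> (inv\<^bsub>?F\<^esub> g \<otimes>\<^bsub>?F\<^esub> a \<otimes>\<^bsub>?F\<^esub> g) \<in> (\<lambda>g. g N) ` R \<Longrightarrow>
          [\<phi> (inv\<^bsub>?F\<^esub> g \<otimes>\<^bsub>?F\<^esub> a \<otimes>\<^bsub>?F\<^esub> g) = 0] (mod int p)"
    and \<phi>r: "\<And>w. w \<in> carrier ?F \<Longrightarrow> N #>\<^bsub>?F\<^esub> w = r N \<Longrightarrow> [\<phi> w = 1] (mod int p)"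
    using exists_character[OF r R Hc HR] by blast
  define V where "V = {f \<in> carrier Q. f N \<in> (\<lambda>g. g N) ` R}"
  note V = open_normal_thickening[OF Rn N V_def]
  have Vn: "V \<lhd> Q" using V(1) by (simp add: open_normal_subgroups_def)
  interpret cm: group_hom ?F Q "completion_map p ?F" by (rule completion_map_hom)
  define K where "K = {u \<in> carrier ?F. completion_map p ?F u \<in> V}"
  have K: "K \<lhd> ?F" unfolding K_def by (rule cm.normal_preimage[OF Vn])
  have K_iff: "u \<in> K \<longleftrightarrow> u \<in> carrier ?F \<and> N #>\<^bsub>?F\<^esub> u \<in> (\<lambda>g. g N) ` R" for u
    using completion_map_closed completion_map_apply[OF N] by (auto simp: K_def V_def)
  define A where "A = {u \<in> carrier ?F. completion_map p ?F u \<in> H}"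
  have A: "subgroup A ?F" unfolding A_def by (rule cm.subgroup_preimage[OF Hsub])
  obtain N3 where N3: "N3 \<in> \<N>"
    "\<And>g C. g \<in> carrier Q \<Longrightarrow> g N3 = r N3 \<Longrightarrow> C \<in> carrier (Q Mod V) \<Longrightarrow>
       d n (completed_group_ring_of p Q T g) V C 1 = d n (completed_group_ring_of p Q T r) V C 1"
    using approximate_mod_p[OF d r(1) V(1,3)] by blast
  \<comment> \<open>A word \<open>w\<close> that agrees with \<open>r\<close> at \<open>N\<close>, so that \<open>\<phi> w\<close> is \<open>1\<close> modulo \<open>p\<close>, and at \<open>N3\<close>, so that its
    derivative has the same residues at \<open>V\<close> as that of \<open>r\<close>.\<close>
  define M where "M = N \<inter> N3"
  have M: "M \<in> \<N>" unfolding M_def by (rule \<N>_Int[OF N N3(1)])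
  obtain w where w: "w \<in> carrier ?F" "r M = M #>\<^bsub>?F\<^esub> w" using Q_coset[OF r(1) M] .
  have wN: "N #>\<^bsub>?F\<^esub> w = r N" using Q_coherent_rcos[OF r(1) M N _ w] by (simp add: M_def)
  have wN3: "completion_map p ?F w N3 = r N3"
    using Q_coherent_rcos[OF r(1) M N3(1) _ w] completion_map_apply[OF N3(1)] by (simp add: M_def)
  have wK: "w \<in> K" using K_iff w(1) wN rR by blast
  have "\<not> int p dvd \<phi> w"
  proof
    assume "int p dvd \<phi> w"
    then have "[0 = 1] (mod int p)" using \<phi>r[OF w(1) wN] by (metis cong_0_iff cong_sym cong_trans)
    then show False using prime_gt_1_nat[OF assms(1)] by (simp add: cong_def)
  qed
  then obtain C where C: "\<not> int p dvd (\<Sum>u\<in>{u \<in> carrier ?F. D (group_ring_of \<Z> ?F w) u \<noteq> 0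
      \<and> K #>\<^bsub>?F\<^esub> u = C}. D (group_ring_of \<Z> ?F w) u)"
    using fox_derivative_mod_nonzero[OF D n K A, of \<phi> "int p" w] wK hom conj genH free_gen_closed
    by (auto simp: K_iff A_def)
  let ?a = "D (group_ring_of \<Z> ?F w)"
  have of: "group_ring_of \<Z> ?F w \<in> carrier (group_ring \<Z> ?F)" by (rule group_ring_of_closed) simp_all
  then have "?a \<in> carrier (group_ring \<Z> ?F)"
    using D unfolding is_discrete_fox_derivative_def by blast
  then have fin: "finite {u \<in> carrier ?F. ?a u \<noteq> 0}" by (rule int_group_ring_finite_support)
  have "{u \<in> carrier ?F. ?a u \<noteq> 0 \<and> K #>\<^bsub>?F\<^esub> u = C} \<noteq> {}" using C by (metis dvd_0_right sum.empty)
  then obtain v where v: "v \<in> carrier ?F" "C = K #>\<^bsub>?F\<^esub> v" by blast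
  let ?q = "\<lambda>u. V #>\<^bsub>Q\<^esub> completion_map p ?F u"
  \<comment> \<open>The quotient of the free group by \<open>K\<close> embeds into the quotient of the completion by \<open>V\<close>.\<close>
  have q: "K #>\<^bsub>?F\<^esub> u = C \<longleftrightarrow> ?q u = ?q v" if u: "u \<in> carrier ?F" for u
  proof -
    have "?q u = ?q v \<longleftrightarrow> completion_map p ?F (u \<otimes>\<^bsub>?F\<^esub> inv\<^bsub>?F\<^esub> v) \<in> V"
      using Q.rcos_eq_iff[OF normal_imp_subgroup[OF Vn], of "completion_map p ?F u" "completion_map p ?F v"] u v(1)
      by simp
    also have "\<dots> \<longleftrightarrow> u \<otimes>\<^bsub>?F\<^esub> inv\<^bsub>?F\<^esub> v \<in> K" using u v(1) by (simp add: K_def)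
    finally show ?thesis using rcos_eq_iff[OF normal_imp_subgroup[OF K] u v(1)] v(2) by simp
  qed
  have y: "?q v \<in> carrier (Q Mod V)" using v(1) completion_map_closed by (simp add: carrier_FactGroup)
  have rc: "completed_group_ring_of p Q T r \<in> carrier (completed_group_ring p Q T)"
    by (rule completed_group_ring_of_closed[OF assms(1) group_Q r(1)])
  then have "d n (completed_group_ring_of p Q T r) \<in> carrier (completed_group_ring p Q T)"
    using continuous_map_image_subset_topspace[OF d] topspace_completed_group_ring[OF assms(1)] by blast
  then have "d n (completed_group_ring_of p Q T r) V (?q v) = \<zero>\<^bsub>padic_int p\<^esub>"
    by (rule Q.completed_group_ring_map_quotient_zero[OF assms(1) topspace_T Rn V(1,2) _
          zero[unfolded unfolds] y])
  then have "0 = d n (completed_group_ring_of p Q T r) V (?q v) 1" by (simp add: padic_int_simps)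
  also have "\<dots> = d n (completed_group_ring_of p Q T (completion_map p ?F w)) V (?q v) 1"
    using N3(2)[OF completion_map_closed[OF w(1)] wN3 y] by simp
  also have "completed_group_ring_of p Q T (completion_map p ?F w)
      = int_free_group_ring_embedding p n (group_ring_of \<Z> ?F w)"
    using int_free_group_ring_embedding_of[OF assms(1) w(1)] unfolding unfolds by simp
  also have "d n \<dots> = int_free_group_ring_embedding p n ?a" by (rule dD[OF of])
  also have "\<dots> V (?q v) 1 = group_ring_map (padic_int p) ?F (Q Mod V) ?q
      (\<lambda>u\<in>carrier ?F. padic_of_int p (?a u)) (?q v) 1"
    using V(1) unfolding int_free_group_ring_embedding_def unfolds by simp
  also have "\<dots> = (\<Sum>u\<in>{u \<in> carrier ?F. ?a u \<noteq> 0 \<and> ?q u = ?q v}. ?a u) mod int p"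
    by (rule group_ring_map_int_mod_p[OF assms(1) fin y])
  also have "{u \<in> carrier ?F. ?a u \<noteq> 0 \<and> ?q u = ?q v} = {u \<in> carrier ?F. ?a u \<noteq> 0 \<and> K #>\<^bsub>?F\<^esub> u = C}"
    using q by blast
  finally have "(\<Sum>u\<in>{u \<in> carrier ?F. ?a u \<noteq> 0 \<and> K #>\<^bsub>?F\<^esub> u = C}. ?a u) mod int p = 0" by (rule sym)
  then show False using C unfolding dvd_eq_mod_eq_0 by (rule notE[rotated])
qed

end
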